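(* Every logic $\mathcal{L} = \langle \mathsf{L}^+,\mathsf{L}^-\rangle \in \mathbf{NExtK4}$ can be defined by a standard Ł-deductive system $\mathsf{S} = \langle Ax, \mathsf{R}\rangle$ (with the modal set of rules) in which every member of $Ax$ is a statement obtained either from an axiom of $\mathbf{K4}$ or from a canonical formula. In other words, there are sets $P, N$ of canonical formulas such that the Ł-deductive system $\mathsf{S}$ with $$Ax = \{\oplus A \mid A \text{ an axiom of } \mathbf{K4}\} \cup \{\oplus A \mid A \in P\} \cup \{\ominus A \mid A \in N\}$$ is standard and, for every $A \in \mathsf{Fm}$, $\vdash_{\mathsf{S}} \oplus A$ if and only if $A \in \mathsf{L}^+$, and $\vdash_{\mathsf{S}} \ominus A$ if and only if $A \in \mathsf{L}^-$.
   Context: $\mathsf{Fm}$ is the set of propositional modal formulas (countably many variables) in the signature $\land,\lor,\to,\sim,\Box$ ($\bot$ abbreviates a fixed contradiction); $\Sigma$ is the set of all simultaneous substitutions of formulas for variables. $\mathbf{K4}$ is the normal modal logic given by a fixed finite set of axioms (axioms of classical propositional logic, $\Box(p\to q)\to(\Box p \to \Box q)$, $\Box p \to \Box\Box p$) and the rules modus ponens, substitution and necessitation. A logic in $\mathbf{NExtK4}$ is here a pair $\langle \mathsf{L}^+, \mathsf{L}^-\rangle$, where $\mathsf{L}^+\subseteq \mathsf{Fm}$ contains $\mathbf{K4}$ and is closed under modus ponens, substitution and necessitation, and $\mathsf{L}^- = \mathsf{Fm}\setminus\mathsf{L}^+$. Statements: for each formula $A$ there is a positive statement $\oplus A$ and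 a negative statement $\ominus A$. An Ł-deductive system is a pair $\mathsf{S} = \langle Ax, \mathsf{R}\rangle$, where $Ax$ is a set of statements (positive members are axioms, negative members are anti-axioms) and $\mathsf{R}$ consists of the rules: (MP) from $\oplus(A \to B)$ and $\oplus A$ infer $\oplus B$; (Sb) from $\oplus A$ infer $\oplus \sigma(A)$, $\sigma \in \Sigma$; (MT) from $\oplus(A \to B)$ and $\ominus B$ infer $\ominus A$; (RS) from $\ominus \sigma(A)$ infer $\ominus A$, $\sigma \in \Sigma$; (NS) from $\oplus A$ infer $\oplus \Box A$; (RN) from $\ominus \Box A$ infer $\ominus A$. An inference of a statement $\alpha$ from a set of statements $\Gamma$ is a finite sequence of statements ending in $\alpha$, each member of which is in $Ax$, or in $\Gamma$, or is obtained from preceding members by one of the rules. $\Gamma \vdash_{\mathsf{S}} \alpha$ means such an inference exists; $\vdash_{\mathsf{S}}\alpha$ means $\emptyset \vdash_{\mathsf{S}} \alpha$. $\mathsf{S}$ is coherent if for no formula $A$ both $\vdash_{\mathsf{S}} \oplus A$ and $\vdash_{\mathsf{S}} \ominus A$; full if for every $A$, $\vdash_{\mathsf{S}} \oplus A$ or $\vdash_{\mathsf{S}} \ominus A$; standard if coherent and full. $\mathsf{S}$ defines the logic $\langle \{A \mid\ \vdash_{\mathsf{S}} \oplus A\}, \{A \mid\ \vdash_{\mathsf{S}} \ominus A\}\rangle$. Canonical formulas (Zakharyaschev, modal case). Let $\mathfrak{F} = \langle W, R\rangle$ be a finite transitive rooted frame with distinct points $a_0,\dots,a_n$, $a_0$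 a root (every point other than $a_0$ is $R$-accessible from $a_0$). Let $D$ be a (possibly empty) set of antichains in $\mathfrak{F}$, an antichain being a nonempty $\mathfrak{d}\subseteq W$ such that $a,b\in \mathfrak{d}$ and $aRb$ imply $a=b$; put $\mathfrak{d}\overline{\uparrow} = \mathfrak{d}\cup\{b \mid \exists a\in \mathfrak{d}\ aRb\}$. Let $\Box^+ A = A\land \Box A$. With variables $p_0,\dots,p_n$ put $$\varphi_{ij} = \Box^+(\Box p_j \to p_i),\qquad \varphi_i = \Box^+\Big(\Big(\bigwedge_{\neg a_i R a_k}\Box p_k \land \bigwedge_{j\ne i} p_j \to p_i\Big)\to p_i\Big),$$ $$\varphi_{\mathfrak{d}} = \Box^+\Big(\bigwedge_{a_i\in W\setminus \mathfrak{d}\overline{\uparrow}}\Box p_i \land \bigwedge_{i=0}^n p_i \to \bigvee_{a_j\in \mathfrak{d}}\Box p_j\Big),\qquad \varphi_\bot = \Box^+\Big(\bigwedge_{i=0}^n \Box^+ p_i\to\bot\Big).$$ The canonical formulas are all $$\alpha(\mathfrak{F},D,\bot) = \bigwedge_{a_iRa_j}\varphi_{ij}\land\bigwedge_{i=0}^n\varphi_i\land\bigwedge_{\mathfrak{d}\in D}\varphi_{\mathfrak{d}}\land\varphi_\bot\to p_0$$ and the formulas $\alpha(\mathfrak{F},D)$ obtained from these by deleting the conjunct $\varphi_\bot$. Empty conjunctions are read as $\top$. *)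

theory Defs
  imports Main
begin

datatype fm =
    Var nat
  | And fm fm  (infixr "\<^bold>\<and>" 60)
  | Or fm fm   (infixr "\<^bold>\<or>" 58)
  | Imp fm fm  (infixr "\<^bold>\<longrightarrow>" 56)
  | Tilde fm   ("\<^bold>\<sim> _" [70] 70)
  | Box fm     ("\<box> _" [70] 70)

(* The signature has no constants; falsum is a fixed contradiction and verum its negation. *)
definition Bot :: fm where
  "Bot = Var 0 \<^bold>\<and> \<^bold>\<sim> Var 0"

definition Top :: fm where
  "Top = \<^bold>\<sim> Bot"

definition Boxp :: "fm \<Rightarrow> fm"  ("\<box>\<^sup>+ _" [70] 70) where
  "\<box>\<^sup>+ A = A \<^bold>\<and> \<box> A"

fun Conj :: "fm list \<Rightarrow> fm" where
  "Conj [] = Top"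
| "Conj [A] = A"
| "Conj (A # B # As) = A \<^bold>\<and> Conj (B # As)"

fun Disj :: "fm list \<Rightarrow> fm" where
  "Disj [] = Bot"
| "Disj [A] = A"
| "Disj (A # B # As) = A \<^bold>\<or> Disj (B # As)"

primrec subst :: "(nat \<Rightarrow> fm) \<Rightarrow> fm \<Rightarrow> fm" where
  "subst \<sigma> (Var v) = \<sigma> v"
| "subst \<sigma> (A \<^bold>\<and> B) = subst \<sigma> A \<^bold>\<and> subst \<sigma> B"
| "subst \<sigma> (A \<^bold>\<or> B) = subst \<sigma> A \<^bold>\<or> subst \<sigma> B"
| "subst \<sigma> (A \<^bold>\<longrightarrow> B) = subst \<sigma> A \<^bold>\<longrightarrow> subst \<sigma> B"
| "subst \<sigma> (\<^bold>\<sim> A) = \<^bold>\<sim> subst \<sigma> A"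
| "subst \<sigma> (\<box> A) = \<box> subst \<sigma> A"

subsection \<open>The logic K4 and its normal extensions\<close>

(* A finite set of formulas, not schemes: instances come from the substitution rule. *)
definition K4_axioms :: "fm set" where
  "K4_axioms = (let p = Var 0; q = Var 1; r = Var 2 in
    {p \<^bold>\<longrightarrow> q \<^bold>\<longrightarrow> p,
     (p \<^bold>\<longrightarrow> q \<^bold>\<longrightarrow> r) \<^bold>\<longrightarrow> (p \<^bold>\<longrightarrow> q) \<^bold>\<longrightarrow> p \<^bold>\<longrightarrow> r,
     p \<^bold>\<and> q \<^bold>\<longrightarrow> p,
     p \<^bold>\<and> q \<^bold>\<longrightarrow> q,
     p \<^bold>\<longrightarrow> q \<^bold>\<longrightarrow> p \<^bold>\<and> q,
     p \<^bold>\<longrightarrow> p \<^bold>\<or> q,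
     q \<^bold>\<longrightarrow> p \<^bold>\<or> q,
     (p \<^bold>\<longrightarrow> r) \<^bold>\<longrightarrow> (q \<^bold>\<longrightarrow> r) \<^bold>\<longrightarrow> p \<^bold>\<or> q \<^bold>\<longrightarrow> r,
     (p \<^bold>\<longrightarrow> q) \<^bold>\<longrightarrow> (p \<^bold>\<longrightarrow> \<^bold>\<sim> q) \<^bold>\<longrightarrow> \<^bold>\<sim> p,
     \<^bold>\<sim> \<^bold>\<sim> p \<^bold>\<longrightarrow> p,
     \<box> (p \<^bold>\<longrightarrow> q) \<^bold>\<longrightarrow> \<box> p \<^bold>\<longrightarrow> \<box> q,
     \<box> p \<^bold>\<longrightarrow> \<box> \<box> p})"

inductive_set K4 :: "fm set" where
  ax:  "A \<in> K4_axioms \<Longrightarrow> A \<in> K4"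
| mp:  "A \<^bold>\<longrightarrow> B \<in> K4 \<Longrightarrow> A \<in> K4 \<Longrightarrow> B \<in> K4"
| sb:  "A \<in> K4 \<Longrightarrow> subst \<sigma> A \<in> K4"
| nec: "A \<in> K4 \<Longrightarrow> \<box> A \<in> K4"

(* A logic is the pair of its theorems and its non-theorems; the inconsistent logic is included. *)
definition NExtK4 :: "(fm set \<times> fm set) set" where
  "NExtK4 = {(Lp, Lm).
     K4 \<subseteq> Lp \<and>
     (\<forall>A B. A \<^bold>\<longrightarrow> B \<in> Lp \<longrightarrow> A \<in> Lp \<longrightarrow> B \<in> Lp) \<and>
     (\<forall>A \<sigma>. A \<in> Lp \<longrightarrow> subst \<sigma> A \<in> Lp) \<and>
     (\<forall>A. A \<in> Lp \<longrightarrow> \<box> A \<in> Lp) \<and>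
     Lm = UNIV - Lp}"

subsection \<open>Deductive systems with positive and negative statements\<close>

datatype stmt =
    Pos fm  ("\<oplus> _" [55] 55)
  | Neg fm  ("\<ominus> _" [55] 55)

(* Rules are given by their instances (premises, conclusion). *)
type_synonym rules = "(stmt set \<times> stmt) set"

type_synonym system = "stmt set \<times> rules"

inductive_set modal_rules :: rules where
  MP: "({\<oplus> (A \<^bold>\<longrightarrow> B), \<oplus> A}, \<oplus> B) \<in> modal_rules"
| Sb: "({\<oplus> A}, \<oplus> (subst \<sigma> A)) \<in> modal_rules"
| MT: "({\<oplus> (A \<^bold>\<longrightarrow> B), \<ominus> B}, \<ominus> A) \<in> modal_rules"
| RS: "({\<ominus> (subst \<sigma> A)}, \<ominus> A) \<in> modal_rules"
| NS: "({\<oplus> A}, \<oplus> (\<box> A)) \<in> modal_rules"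
| RN: "({\<ominus> (\<box> A)}, \<ominus> A) \<in> modal_rules"

definition inference :: "system \<Rightarrow> stmt set \<Rightarrow> stmt list \<Rightarrow> stmt \<Rightarrow> bool" where
  "inference S \<Gamma> xs \<alpha> \<longleftrightarrow>
     xs \<noteq> [] \<and> last xs = \<alpha> \<and>
     (\<forall>i < length xs.
        xs ! i \<in> fst S \<or> xs ! i \<in> \<Gamma> \<or>
        (\<exists>prems. prems \<subseteq> set (take i xs) \<and> (prems, xs ! i) \<in> snd S))"

definition derives :: "system \<Rightarrow> stmt set \<Rightarrow> stmt \<Rightarrow> bool" where
  "derives S \<Gamma> \<alpha> \<longleftrightarrow> (\<exists>xs. inference S \<Gamma> xs \<alpha>)"

abbreviation derivable :: "system \<Rightarrow> stmt \<Rightarrow> bool" where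
  "derivable S \<alpha> \<equiv> derives S {} \<alpha>"

definition coherent_system :: "system \<Rightarrow> bool" where
  "coherent_system S \<longleftrightarrow> \<not> (\<exists>A. derivable S (\<oplus> A) \<and> derivable S (\<ominus> A))"

definition full_system :: "system \<Rightarrow> bool" where
  "full_system S \<longleftrightarrow> (\<forall>A. derivable S (\<oplus> A) \<or> derivable S (\<ominus> A))"

definition standard_system :: "system \<Rightarrow> bool" where
  "standard_system S \<longleftrightarrow> coherent_system S \<and> full_system S"

subsection \<open>Canonical formulas\<close>

(* Only the indices of the points a_0, ..., a_n enter the formulas, so frames have
   W = {..n} with a_i = i and root 0; this loses nothing up to isomorphism. *)
definition rooted_frame :: "nat \<Rightarrow> (nat \<times> nat) set \<Rightarrow> bool" where
  "rooted_frame n R \<longleftrightarrow>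
     R \<subseteq> {..n} \<times> {..n} \<and> trans R \<and> (\<forall>i\<in>{..n}. i \<noteq> 0 \<longrightarrow> (0, i) \<in> R)"

(* Reflexive points are allowed in antichains. *)
definition is_antichain :: "nat \<Rightarrow> (nat \<times> nat) set \<Rightarrow> nat set \<Rightarrow> bool" where
  "is_antichain n R d \<longleftrightarrow>
     d \<noteq> {} \<and> d \<subseteq> {..n} \<and> (\<forall>a\<in>d. \<forall>b\<in>d. (a, b) \<in> R \<longrightarrow> a = b)"

definition upc :: "(nat \<times> nat) set \<Rightarrow> nat set \<Rightarrow> nat set" where
  "upc R d = d \<union> {b. \<exists>a\<in>d. (a, b) \<in> R}"

definition phi_rel :: "nat \<Rightarrow> nat \<Rightarrow> fm" where
  "phi_rel i j = \<box>\<^sup>+ (\<box> Var j \<^bold>\<longrightarrow> Var i)"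

definition phi_pt :: "nat \<Rightarrow> (nat \<times> nat) set \<Rightarrow> nat \<Rightarrow> fm" where
  "phi_pt n R i =
     \<box>\<^sup>+ ((Conj [\<box> Var k. k \<leftarrow> [0..<Suc n], (i, k) \<notin> R] \<^bold>\<and>
          Conj [Var j. j \<leftarrow> [0..<Suc n], j \<noteq> i] \<^bold>\<longrightarrow> Var i) \<^bold>\<longrightarrow> Var i)"

definition phi_dom :: "nat \<Rightarrow> (nat \<times> nat) set \<Rightarrow> nat set \<Rightarrow> fm" where
  "phi_dom n R d =
     \<box>\<^sup>+ (Conj [\<box> Var i. i \<leftarrow> [0..<Suc n], i \<notin> upc R d] \<^bold>\<and>
         Conj [Var i. i \<leftarrow> [0..<Suc n]] \<^bold>\<longrightarrow>
         Disj [\<box> Var j. j \<leftarrow> [0..<Suc n], j \<in> d])"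

definition phi_bot :: "nat \<Rightarrow> fm" where
  "phi_bot n = \<box>\<^sup>+ (Conj [\<box>\<^sup>+ Var i. i \<leftarrow> [0..<Suc n]] \<^bold>\<longrightarrow> Bot)"

(* The list of subsequences of [0..<Suc n] contains every subset of {..n} exactly once;
   it fixes the order of the conjuncts over D. *)
definition alpha :: "nat \<Rightarrow> (nat \<times> nat) set \<Rightarrow> nat set set \<Rightarrow> fm" where
  "alpha n R D =
     Conj [phi_rel i j. i \<leftarrow> [0..<Suc n], j \<leftarrow> [0..<Suc n], (i, j) \<in> R] \<^bold>\<and>
     Conj [phi_pt n R i. i \<leftarrow> [0..<Suc n]] \<^bold>\<and>
     Conj [phi_dom n R d. d \<leftarrow> map set (subseqs [0..<Suc n]), d \<in> D]
     \<^bold>\<longrightarrow> Var 0"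

definition alpha_bot :: "nat \<Rightarrow> (nat \<times> nat) set \<Rightarrow> nat set set \<Rightarrow> fm" where
  "alpha_bot n R D =
     Conj [phi_rel i j. i \<leftarrow> [0..<Suc n], j \<leftarrow> [0..<Suc n], (i, j) \<in> R] \<^bold>\<and>
     Conj [phi_pt n R i. i \<leftarrow> [0..<Suc n]] \<^bold>\<and>
     Conj [phi_dom n R d. d \<leftarrow> map set (subseqs [0..<Suc n]), d \<in> D] \<^bold>\<and>
     phi_bot n
     \<^bold>\<longrightarrow> Var 0"

definition canonical_formulas :: "fm set" where
  "canonical_formulas =
     {alpha n R D | n R D. rooted_frame n R \<and> (\<forall>d\<in>D. is_antichain n R d)} \<union>
     {alpha_bot n R D | n R D. rooted_frame n R \<and> (\<forall>d\<in>D. is_antichain n R d)}"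

end

theory Submission
  imports Defs
begin

text \<open>Everything reduces to one fact: if \<open>A\<close> is not in a normal extension \<open>L\<close> of K4, then some
  canonical formula \<open>\<alpha> \<notin> L\<close> and some substitution \<open>\<sigma>\<close> satisfy \<open>\<sigma>(A) \<rightarrow> \<alpha> \<in> K4\<close>. With \<open>P\<close> the
  canonical formulas inside \<open>L\<close> and \<open>N\<close> those outside, \<open>\<ominus> \<alpha>\<close> then yields \<open>\<ominus> A\<close> by (MT) and (RS), and
  applying the fact to the logic axiomatised by \<open>P\<close> shows that this logic is \<open>L\<close>.

  To find \<open>\<alpha>\<close>, call the set of true subformulas of \<open>A\<close> the type of a point of the canonical model of
  \<open>L\<close>. In stages, select the points above which the types of the remaining points and the classes
  already selected stay constant, classify them by these data, and discard the remaining points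
  that see a selected point of their own type. Every point surviving a stage sees one more type
  among the selected points, so this stops. The selected points form finitely many definable
  classes, on which the model is p-morphic to a finite model refuting \<open>A\<close>; a discarded point sees a
  selected point of the same type. Taking as closed domains exactly the antichains for which the
  finite model offers no type for a discarded point, one obtains a canonical formula refuted in \<open>L\<close>,
  and conversely any refutation of it pulls back, uniformly, to a refutation of \<open>A\<close> at the same
  point.\<close>

section \<open>Satisfaction\<close>

primrec sat :: "('w \<times> 'w) set \<Rightarrow> ('w \<Rightarrow> nat \<Rightarrow> bool) \<Rightarrow> 'w \<Rightarrow> fm \<Rightarrow> bool" where
  "sat R V x (Var v) \<longleftrightarrow> V x v"
| "sat R V x (A \<^bold>\<and> B) \<longleftrightarrow> sat R V x A \<and> sat R V x B"
| "sat R V x (A \<^bold>\<or> B) \<longleftrightarrow> sat R V x A \<or> sat R V x B"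
| "sat R V x (A \<^bold>\<longrightarrow> B) \<longleftrightarrow> (sat R V x A \<longrightarrow> sat R V x B)"
| "sat R V x (\<^bold>\<sim> A) \<longleftrightarrow> \<not> sat R V x A"
| "sat R V x (\<box> A) \<longleftrightarrow> (\<forall>y. (x, y) \<in> R \<longrightarrow> sat R V y A)"

lemma sat_Bot [simp]: "\<not> sat R V x Bot"
  by (simp add: Bot_def)

lemma sat_Top [simp]: "sat R V x Top"
  by (simp add: Top_def)

lemma sat_Boxp [simp]: "sat R V x (\<box>\<^sup>+ A) \<longleftrightarrow> (\<forall>y. (x, y) \<in> R\<^sup>= \<longrightarrow> sat R V y A)"
  by (auto simp: Boxp_def)

lemma sat_Conj [simp]: "sat R V x (Conj As) \<longleftrightarrow> (\<forall>A\<in>set As. sat R V x A)"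
  by (induction As rule: Conj.induct) auto

lemma sat_Disj [simp]: "sat R V x (Disj As) \<longleftrightarrow> (\<exists>A\<in>set As. sat R V x A)"
  by (induction As rule: Disj.induct) auto

lemma sat_subst:
  "sat R V x (subst \<sigma> A) \<longleftrightarrow> sat R (\<lambda>y q. sat R V y (\<sigma> q)) x A"
  by (induction A arbitrary: x) auto

text \<open>\<open>S\<close> is closed under successors, so truth at its points depends only on the
  valuation inside \<open>S\<close>. This matters where two valuations agree only above one
  point.\<close>

lemma sat_cong:
  assumes "\<And>y q. y \<in> S \<Longrightarrow> V y q \<longleftrightarrow> V' y q" "R `` S \<subseteq> S" "x \<in> S"
  shows "sat R V x A \<longleftrightarrow> sat R V' x A"
  using assms(3)
proof (induction A arbitrary: x)
  case (Box A)
  then have "sat R V y A \<longleftrightarrow> sat R V' y A" if "(x, y) \<in> R" for y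
    using assms(2) that by blast
  then show ?case by simp
qed (simp_all add: assms(1))

primrec subfms :: "fm \<Rightarrow> fm set" where
  "subfms (Var v) = {Var v}"
| "subfms (A \<^bold>\<and> B) = insert (A \<^bold>\<and> B) (subfms A \<union> subfms B)"
| "subfms (A \<^bold>\<or> B) = insert (A \<^bold>\<or> B) (subfms A \<union> subfms B)"
| "subfms (A \<^bold>\<longrightarrow> B) = insert (A \<^bold>\<longrightarrow> B) (subfms A \<union> subfms B)"
| "subfms (\<^bold>\<sim> A) = insert (\<^bold>\<sim> A) (subfms A)"
| "subfms (\<box> A) = insert (\<box> A) (subfms A)"

lemma finite_subfms: "finite (subfms A)"
  by (induction A) auto

lemma subfms_refl: "A \<in> subfms A"
  by (cases A) auto

lemma subfms_trans: "B \<in> subfms A \<Longrightarrow> subfms B \<subseteq> subfms A"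
  by (induction A) auto

lemma subfms_Box: "\<box> B \<in> subfms A \<Longrightarrow> B \<in> subfms A"
  using subfms_trans[of "\<box> B" A] subfms_refl[of B] by auto

section \<open>Canonical models\<close>

locale normal_logic =
  fixes L :: "fm set"
  assumes logic_K4: "K4 \<subseteq> L"
    and logic_mp: "A \<^bold>\<longrightarrow> B \<in> L \<Longrightarrow> A \<in> L \<Longrightarrow> B \<in> L"
    and logic_sb: "A \<in> L \<Longrightarrow> subst \<sigma> A \<in> L"
    and logic_nec: "A \<in> L \<Longrightarrow> \<box> A \<in> L"
begin

section \<open>Derivability from hypotheses\<close>

lemma axiom_instances:
  "subst (\<lambda>v. if v = 0 then p else if v = 1 then q else r) ` K4_axioms \<subseteq> L"
  using logic_sb logic_K4 K4.ax by blast

lemma ax_K: "p \<^bold>\<longrightarrow> q \<^bold>\<longrightarrow> p \<in> L"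
  and ax_S: "(p \<^bold>\<longrightarrow> q \<^bold>\<longrightarrow> r) \<^bold>\<longrightarrow> (p \<^bold>\<longrightarrow> q) \<^bold>\<longrightarrow> p \<^bold>\<longrightarrow> r \<in> L"
  and ax_and1: "p \<^bold>\<and> q \<^bold>\<longrightarrow> p \<in> L"
  and ax_and2: "p \<^bold>\<and> q \<^bold>\<longrightarrow> q \<in> L"
  and ax_and3: "p \<^bold>\<longrightarrow> q \<^bold>\<longrightarrow> p \<^bold>\<and> q \<in> L"
  and ax_or1: "p \<^bold>\<longrightarrow> p \<^bold>\<or> q \<in> L"
  and ax_or2: "q \<^bold>\<longrightarrow> p \<^bold>\<or> q \<in> L"
  and ax_or3: "(p \<^bold>\<longrightarrow> r) \<^bold>\<longrightarrow> (q \<^bold>\<longrightarrow> r) \<^bold>\<longrightarrow> p \<^bold>\<or> q \<^bold>\<longrightarrow> r \<in> L"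
  and ax_neg: "(p \<^bold>\<longrightarrow> q) \<^bold>\<longrightarrow> (p \<^bold>\<longrightarrow> \<^bold>\<sim> q) \<^bold>\<longrightarrow> \<^bold>\<sim> p \<in> L"
  and ax_dne: "\<^bold>\<sim> \<^bold>\<sim> p \<^bold>\<longrightarrow> p \<in> L"
  and ax_norm: "\<box> (p \<^bold>\<longrightarrow> q) \<^bold>\<longrightarrow> \<box> p \<^bold>\<longrightarrow> \<box> q \<in> L"
  and ax_4: "\<box> p \<^bold>\<longrightarrow> \<box> \<box> p \<in> L"
  using axiom_instances[of p q r]
  by (simp_all add: K4_axioms_def Let_def)

text \<open>Necessitation is no rule here: it acts only inside \<open>L\<close>, and this is what
  makes the deduction theorem hold.\<close>

inductive_set ded :: "fm set \<Rightarrow> fm set" for \<Gamma> where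
  base: "A \<in> L \<Longrightarrow> A \<in> ded \<Gamma>"
| hyp: "A \<in> \<Gamma> \<Longrightarrow> A \<in> ded \<Gamma>"
| mp: "A \<^bold>\<longrightarrow> B \<in> ded \<Gamma> \<Longrightarrow> A \<in> ded \<Gamma> \<Longrightarrow> B \<in> ded \<Gamma>"

lemma ded_mono: "A \<in> ded \<Gamma> \<Longrightarrow> \<Gamma> \<subseteq> \<Delta> \<Longrightarrow> A \<in> ded \<Delta>"
  by (induction rule: ded.induct) (auto intro: ded.intros)

lemma ded_empty: "A \<in> ded {} \<Longrightarrow> A \<in> L"
  by (induction rule: ded.induct) (auto intro: logic_mp)

lemma ded_mp1: "A \<^bold>\<longrightarrow> B \<in> L \<Longrightarrow> A \<in> ded \<Gamma> \<Longrightarrow> B \<in> ded \<Gamma>"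
  by (rule ded.mp[OF ded.base])

lemma ded_mp2: "A \<^bold>\<longrightarrow> B \<^bold>\<longrightarrow> C \<in> L \<Longrightarrow> A \<in> ded \<Gamma> \<Longrightarrow> B \<in> ded \<Gamma> \<Longrightarrow> C \<in> ded \<Gamma>"
  by (rule ded.mp[OF ded_mp1])

lemma deduction: "B \<in> ded (insert A \<Gamma>) \<Longrightarrow> A \<^bold>\<longrightarrow> B \<in> ded \<Gamma>"
proof (induction rule: ded.induct)
  case (base B)
  then show ?case by (rule ded_mp1[OF ax_K ded.base])
next
  case (hyp B)
  have "A \<^bold>\<longrightarrow> A \<in> ded \<Gamma>"
    by (rule ded_mp2[OF ax_S[of A "A \<^bold>\<longrightarrow> A" A] ded.base[OF ax_K] ded.base[OF ax_K]])
  moreover have "B \<in> \<Gamma> \<Longrightarrow> A \<^bold>\<longrightarrow> B \<in> ded \<Gamma>"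
    by (rule ded_mp1[OF ax_K ded.hyp])
  ultimately show ?case using hyp by auto
next
  case (mp B C)
  then show ?case using ded_mp2[OF ax_S[of A B C]] by simp
qed

lemma ded_explosion:
  assumes "B \<in> ded \<Gamma>" "\<^bold>\<sim> B \<in> ded \<Gamma>"
  shows "A \<in> ded \<Gamma>"
proof -
  have "\<^bold>\<sim> \<^bold>\<sim> A \<in> ded \<Gamma>"
    by (rule ded_mp2[OF ax_neg ded_mp1[OF ax_K assms(1)] ded_mp1[OF ax_K assms(2)]])
  then show ?thesis by (rule ded_mp1[OF ax_dne])
qed

text \<open>By contraposition the negation of \<open>A\<close> implies both the negation and the
  double negation of \<open>B\<close>; so \<open>A\<close> follows by double negation
  elimination.\<close>

lemma ded_cases:
  assumes "B \<^bold>\<longrightarrow> A \<in> ded \<Gamma>" "\<^bold>\<sim> B \<^bold>\<longrightarrow> A \<in> ded \<Gamma>"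
  shows "A \<in> ded \<Gamma>"
proof -
  let ?\<Delta> = "insert (\<^bold>\<sim> A) \<Gamma>"
  have n: "C \<^bold>\<longrightarrow> \<^bold>\<sim> A \<in> ded ?\<Delta>" for C
    by (rule ded_mp1[OF ax_K ded.hyp]) simp
  have "C \<^bold>\<longrightarrow> A \<in> ded ?\<Delta> \<Longrightarrow> \<^bold>\<sim> A \<^bold>\<longrightarrow> \<^bold>\<sim> C \<in> ded \<Gamma>" for C
    by (rule deduction[OF ded_mp2[OF ax_neg _ n]])
  then have "\<^bold>\<sim> A \<^bold>\<longrightarrow> \<^bold>\<sim> B \<in> ded \<Gamma>" "\<^bold>\<sim> A \<^bold>\<longrightarrow> \<^bold>\<sim> \<^bold>\<sim> B \<in> ded \<Gamma>"
    using assms ded_mono subset_insertI by metis+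
  then have "\<^bold>\<sim> \<^bold>\<sim> A \<in> ded \<Gamma>" by (rule ded_mp2[OF ax_neg])
  then show ?thesis by (rule ded_mp1[OF ax_dne])
qed

text \<open>The premises of a modus ponens come from two members of the chain, and the larger one
  derives both. This makes Zorn's lemma applicable to the sets that do not derive a given
  formula.\<close>

lemma ded_compact:
  assumes "A \<in> ded (\<Union>\<C>)" "\<C> \<noteq> {}" "subset.chain UNIV \<C>"
  shows "\<exists>\<Gamma>\<in>\<C>. A \<in> ded \<Gamma>"
  using assms(1)
proof (induction rule: ded.induct)
  case (base A)
  then show ?case using assms(2) by (auto intro: ded.base)
next
  case (hyp A)
  then show ?case by (auto intro: ded.hyp)
next
  case (mp A B)
  then obtain \<Gamma> \<Delta> where *: "\<Gamma> \<in> \<C>" "\<Delta> \<in> \<C>" "A \<^bold>\<longrightarrow> B \<in> ded \<Gamma>" "A \<in> ded \<Delta>" by blast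
  then have "\<Gamma> \<subseteq> \<Delta> \<or> \<Delta> \<subseteq> \<Gamma>" using assms(3) by (auto simp: subset_chain_def)
  with * have "A \<^bold>\<longrightarrow> B \<in> ded (\<Gamma> \<union> \<Delta>)" "A \<in> ded (\<Gamma> \<union> \<Delta>)" "\<Gamma> \<union> \<Delta> \<in> \<C>"
    using ded_mono by (blast, blast, metis Un_absorb1 Un_absorb2)
  then show ?case using ded.mp by metis
qed

section \<open>Complete theories and the canonical model\<close>

definition world :: "fm set \<Rightarrow> bool" where
  "world X \<longleftrightarrow> L \<subseteq> X \<and> (\<forall>A B. A \<^bold>\<longrightarrow> B \<in> X \<longrightarrow> A \<in> X \<longrightarrow> B \<in> X) \<and>
     (\<forall>A. \<^bold>\<sim> A \<in> X \<longleftrightarrow> A \<notin> X)"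

text \<open>A set maximal among those not deriving \<open>A\<close> contains each \<open>B\<close>
  or its negation: otherwise both would imply \<open>A\<close>, and a case distinction would derive
  \<open>A\<close>.\<close>

lemma lindenbaum:
  assumes "A \<notin> ded \<Gamma>"
  shows "\<exists>X. world X \<and> \<Gamma> \<subseteq> X \<and> A \<notin> X"
proof -
  let ?S = "{\<Delta>. \<Gamma> \<subseteq> \<Delta> \<and> A \<notin> ded \<Delta>}"
  have "\<exists>M\<in>?S. \<forall>X\<in>?S. M \<subseteq> X \<longrightarrow> X = M"
  proof (rule subset_Zorn_nonempty)
    show "?S \<noteq> {}" using assms by blast
    fix \<C> assume \<C>: "\<C> \<noteq> {}" "subset.chain ?S \<C>"
    then have sub: "\<C> \<subseteq> ?S" and ch: "subset.chain UNIV \<C>"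
      by (auto simp: subset_chain_def)
    then have "A \<notin> ded (\<Union>\<C>)" using ded_compact[OF _ \<C>(1) ch] by blast
    moreover have "\<Gamma> \<subseteq> \<Union>\<C>" using \<C>(1) sub by blast
    ultimately show "\<Union>\<C> \<in> ?S" by simp
  qed
  then obtain X where X: "\<Gamma> \<subseteq> X" "A \<notin> ded X"
    and max: "\<And>Y. \<Gamma> \<subseteq> Y \<Longrightarrow> A \<notin> ded Y \<Longrightarrow> X \<subseteq> Y \<Longrightarrow> Y = X" by auto
  have ins: "B \<^bold>\<longrightarrow> A \<in> ded X" if "B \<notin> X" for B
  proof (rule deduction, rule ccontr)
    assume "A \<notin> ded (insert B X)"
    then have "insert B X = X" using X(1) by (intro max) auto
    with that show False by blast
  qed
  have closed: "B \<in> X" if "B \<in> ded X" for B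
    using ins[of B] X(2) ded.mp[OF _ that] by auto
  have "\<^bold>\<sim> B \<in> X \<longleftrightarrow> B \<notin> X" for B
    using ded_explosion[OF ded.hyp ded.hyp, of B X A] ded_cases[OF ins ins, of B] X(2) by auto
  moreover have "C \<in> X" if "B \<^bold>\<longrightarrow> C \<in> X" "B \<in> X" for B C
    by (rule closed[OF ded.mp[OF ded.hyp ded.hyp]]) (fact that)+
  moreover have "L \<subseteq> X" by (auto intro: closed ded.base)
  ultimately have "world X" unfolding world_def by simp
  moreover have "A \<notin> X" using X(2) ded.hyp[of A X] by auto
  ultimately show ?thesis using X(1) by auto
qed

definition worlds :: "fm set set" where
  "worlds = {X. world X}"

definition acc :: "(fm set \<times> fm set) set" where
  "acc = {(X, Y). world X \<and> world Y \<and> (\<forall>B. \<box> B \<in> X \<longrightarrow> B \<in> Y)}"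

definition val :: "fm set \<Rightarrow> nat \<Rightarrow> bool" where
  "val X v \<longleftrightarrow> Var v \<in> X"

lemma trans_acc: "trans acc"
proof (rule transI)
  fix X Y Z assume *: "(X, Y) \<in> acc" "(Y, Z) \<in> acc"
  have "\<box> \<box> B \<in> X" if "\<box> B \<in> X" for B
    using * that ax_4[of B] by (auto simp: acc_def world_def)
  with * show "(X, Z) \<in> acc" by (auto simp: acc_def)
qed

lemma world_Tilde: "world X \<Longrightarrow> \<^bold>\<sim> A \<in> X \<longleftrightarrow> A \<notin> X"
  by (simp add: world_def)

lemma world_Imp: "world X \<Longrightarrow> A \<^bold>\<longrightarrow> B \<in> X \<longleftrightarrow> (A \<in> X \<longrightarrow> B \<in> X)"
proof
  assume X: "world X" and *: "A \<in> X \<longrightarrow> B \<in> X"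
  have L: "C \<in> X" if "C \<in> L" for C using X that by (auto simp: world_def)
  have mp: "D \<in> X" if "C \<^bold>\<longrightarrow> D \<in> X" "C \<in> X" for C D using X that by (auto simp: world_def)
  show "A \<^bold>\<longrightarrow> B \<in> X"
  proof (cases "B \<in> X")
    case True
    then show ?thesis using L ax_K mp by blast
  next
    case False
    then have "\<^bold>\<sim> A \<in> X" using * X by (auto simp: world_def)
    have "B \<in> ded {A, \<^bold>\<sim> A}"
      by (rule ded_explosion[of A]; rule ded.hyp) simp_all
    then have "\<^bold>\<sim> A \<^bold>\<longrightarrow> A \<^bold>\<longrightarrow> B \<in> L"
      by (simp add: deduction ded_empty)
    with \<open>\<^bold>\<sim> A \<in> X\<close> show ?thesis using L mp by blast
  qed
qed (auto simp: world_def)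

lemma truth: "world X \<Longrightarrow> sat acc val X A \<longleftrightarrow> A \<in> X"
proof (induction A arbitrary: X)
  case (Var v)
  show ?case by (simp add: val_def)
next
  case (And A B)
  have L: "C \<in> X" if "C \<in> L" for C using And.prems that by (auto simp: world_def)
  show ?case
    using And L[OF ax_and1[of A B]] L[OF ax_and2[of A B]] L[OF ax_and3[of A B]]
    by (auto simp: world_Imp)
next
  case (Or A B)
  have L: "C \<in> X" if "C \<in> L" for C using Or.prems that by (auto simp: world_def)
  \<comment> \<open>If neither disjunct is in \<open>X\<close>, both vacuously imply the negation of
    the disjunction. By \<open>ax_or3\<close> so does the disjunction itself, which therefore is not
    in \<open>X\<close>.\<close>
  show ?case
    using Or L[OF ax_or1[of A B]] L[OF ax_or2[of B A]]
      L[OF ax_or3[of A "\<^bold>\<sim> (A \<^bold>\<or> B)" B]] world_Tilde[of X "A \<^bold>\<or> B"]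
    by (auto simp: world_Imp)
next
  case (Imp A B)
  then show ?case by (simp add: world_Imp)
next
  case (Tilde A)
  then show ?case by (simp add: world_Tilde)
next
  case (Box A)
  have L: "C \<in> X" if "C \<in> L" for C using Box.prems that by (auto simp: world_def)
  have "\<box> A \<in> X" if all: "\<And>Y. (X, Y) \<in> acc \<Longrightarrow> A \<in> Y"
  proof -
    \<comment> \<open>By necessitation and normality, \<open>X\<close> contains the box of
      everything that follows from the formulas whose box it contains. If \<open>\<box> A\<close> is
      missing, these do not derive \<open>A\<close>, and a world that extends them without
      \<open>A\<close> is a successor of \<open>X\<close>.\<close>
    have box: "\<box> B \<in> X" if "B \<in> ded {C. \<box> C \<in> X}" for B
      using that
    proof (induction rule: ded.induct)
      case (base B)
      then show ?case using L logic_nec by blast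
    next
      case (mp B C)
      then show ?case using L[OF ax_norm[of B C]] Box.prems by (auto simp: world_Imp)
    qed auto
    show ?thesis
    proof (rule ccontr)
      assume "\<box> A \<notin> X"
      then obtain Y where "world Y" "{C. \<box> C \<in> X} \<subseteq> Y" "A \<notin> Y"
        using box lindenbaum by metis
      then show False using all[of Y] Box.prems by (auto simp: acc_def)
    qed
  qed
  moreover have "A \<in> Y" if "(X, Y) \<in> acc" "\<box> A \<in> X" for Y
    using that by (auto simp: acc_def)
  moreover have "sat acc val Y A \<longleftrightarrow> A \<in> Y" if "(X, Y) \<in> acc" for Y
    using Box.IH that by (auto simp: acc_def)
  ultimately show ?case by auto
qed

lemma countermodel:
  assumes "A \<notin> L"
  obtains X where "X \<in> worlds" "\<not> sat acc val X A"
proof -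
  have "A \<notin> ded {}" using assms ded_empty by metis
  then obtain X where "world X" "A \<notin> X" using lindenbaum by metis
  with that show thesis by (auto simp: worlds_def truth)
qed

lemma theorem_sat: "A \<in> L \<Longrightarrow> X \<in> worlds \<Longrightarrow> sat acc val X A"
  using truth by (auto simp: world_def worlds_def)

end

section \<open>Selecting a finite definable p-morphic image\<close>

text \<open>An abstraction of the canonical model: \<open>\<D>\<close> stands for the sets defined
  by formulas, of which the selection uses only closure under Boolean operations and
  possibility.\<close>

locale general_frame =
  fixes W :: "'w set" and R :: "('w \<times> 'w) set" and \<D> :: "'w set set"
  assumes R: "R \<subseteq> W \<times> W" and trans: "trans R"
    and Diff: "P \<in> \<D> \<Longrightarrow> W - P \<in> \<D>"
    and Int: "P \<in> \<D> \<Longrightarrow> Q \<in> \<D> \<Longrightarrow> P \<inter> Q \<in> \<D>"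
    and dia: "P \<in> \<D> \<Longrightarrow> R\<inverse> `` P \<in> \<D>"
    and top: "W \<in> \<D>" and Pow: "\<D> \<subseteq> Pow W"
begin

text \<open>Predicates instead of sets let definability be checked along the logical form of a
  condition.\<close>

definition dfn :: "('w \<Rightarrow> bool) \<Rightarrow> bool" where
  "dfn P \<longleftrightarrow> {x \<in> W. P x} \<in> \<D>"

lemma dfn_not: "dfn P \<Longrightarrow> dfn (\<lambda>x. \<not> P x)"
proof -
  have "{x \<in> W. \<not> P x} = W - {x \<in> W. P x}" by blast
  then show "dfn P \<Longrightarrow> ?thesis" using Diff by (simp add: dfn_def)
qed

lemma dfn_conj: "dfn P \<Longrightarrow> dfn Q \<Longrightarrow> dfn (\<lambda>x. P x \<and> Q x)"
proof -
  have "{x \<in> W. P x \<and> Q x} = {x \<in> W. P x} \<inter> {x \<in> W. Q x}" by blast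
  then show "dfn P \<Longrightarrow> dfn Q \<Longrightarrow> ?thesis" using Int by (simp add: dfn_def)
qed

lemma dfn_imp: "dfn P \<Longrightarrow> dfn Q \<Longrightarrow> dfn (\<lambda>x. P x \<longrightarrow> Q x)"
  using dfn_not[OF dfn_conj[OF _ dfn_not], of P Q] by simp

lemma dfn_const: "dfn (\<lambda>x. c)"
  using top Diff[OF top] by (cases c) (auto simp: dfn_def)

lemma dfn_eq_const: "dfn P \<Longrightarrow> dfn (\<lambda>x. P x = c)"
  by (cases c) (auto dest: dfn_not)

lemma dfn_mem: "P \<in> \<D> \<Longrightarrow> dfn (\<lambda>x. x \<in> P)"
proof -
  assume "P \<in> \<D>"
  moreover from this have "{x \<in> W. x \<in> P} = P" using Pow by auto
  ultimately show ?thesis by (simp add: dfn_def)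
qed

lemma dfn_dia: "dfn P \<Longrightarrow> dfn (\<lambda>x. \<exists>y. (x, y) \<in> R \<and> P y)"
proof -
  have "{x \<in> W. \<exists>y. (x, y) \<in> R \<and> P y} = R\<inverse> `` {x \<in> W. P x}" using R by blast
  then show "dfn P \<Longrightarrow> ?thesis" using dia by (simp add: dfn_def)
qed

lemma dfn_ball: "finite I \<Longrightarrow> (\<And>i. i \<in> I \<Longrightarrow> dfn (P i)) \<Longrightarrow> dfn (\<lambda>x. \<forall>i\<in>I. P i x)"
proof (induction I rule: finite_induct)
  case empty
  show ?case using dfn_const[of True] by simp
next
  case (insert i I)
  then have "dfn (\<lambda>x. P i x \<and> (\<forall>i\<in>I. P i x))" by (intro dfn_conj) auto
  then show ?case by simp
qed

text \<open>The equation is a finite conjunction of conditions \<open>P i\<close> and their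
  negations.\<close>

lemma dfn_set_eq:
  assumes "finite I" "\<And>i. i \<in> I \<Longrightarrow> dfn (P i)" "J \<subseteq> I"
  shows "dfn (\<lambda>x. {i \<in> I. P i x} = J)"
proof -
  have "({i \<in> I. P i x} = J) = (\<forall>i\<in>I. P i x = (i \<in> J))" for x
    using assms(3) by blast
  then show ?thesis
    using dfn_ball[OF assms(1), of "\<lambda>i x. P i x = (i \<in> J)"] dfn_eq_const assms(2) by simp
qed

end

text \<open>The points outside \<open>Y \<union> \<Union>\<Pi>\<close> are discarded for good: each of them sees a selected
  point of its own type. The last assumption bounds the number of stages.\<close>

locale stage = general_frame W R \<D> for W :: "'w set" and R \<D> +
  fixes t :: "'w \<Rightarrow> 't" and k :: nat and \<Pi> :: "'w set set" and Y :: "'w set"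
  assumes finite_classes: "finite \<Pi>" and definable_classes: "\<Pi> \<subseteq> \<D>" and definable_rest: "Y \<in> \<D>" and disjoint_classes: "pairwise disjnt \<Pi>"
    and rest_disjoint: "Y \<inter> \<Union>\<Pi> = {}"
    and same_type: "\<And>P x x'. P \<in> \<Pi> \<Longrightarrow> x \<in> P \<Longrightarrow> x' \<in> P \<Longrightarrow> t x = t x'"
    and p_morphic: "\<And>P Q x x'. P \<in> \<Pi> \<Longrightarrow> Q \<in> \<Pi> \<Longrightarrow> x \<in> P \<Longrightarrow> x' \<in> P \<Longrightarrow> \<exists>y\<in>Q. (x, y) \<in> R \<Longrightarrow>
      \<exists>y\<in>Q. (x', y) \<in> R"
    and discarded: "\<And>y. y \<in> W \<Longrightarrow> y \<notin> Y \<Longrightarrow> y \<notin> \<Union>\<Pi> \<Longrightarrow> \<exists>z\<in>\<Union>\<Pi>. (y, z) \<in> R \<and> t z = t y"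
    and new_type: "\<And>y z. y \<in> Y \<Longrightarrow> z \<in> \<Union>\<Pi> \<Longrightarrow> (y, z) \<in> R \<Longrightarrow> t z \<noteq> t y"
    and no_return: "\<And>x y. x \<in> \<Union>\<Pi> \<Longrightarrow> y \<in> Y \<Longrightarrow> (x, y) \<notin> R"
    and many_types: "\<And>y. y \<in> Y \<Longrightarrow> k \<le> card (t ` {z \<in> \<Union>\<Pi>. (y, z) \<in> R})"
begin

text \<open>The old classes see nothing in \<open>Y\<close>, and inside \<open>Y\<close> the new
  ones see only points of \<open>S\<close>. Hence later stages never disturb the classes already
  formed.\<close>

lemma step:
  assumes fin: "finite (t ` W)" and dt: "\<And>\<tau>. dfn (\<lambda>x. t x = \<tau>)"
  shows "\<exists>\<Pi>' Y'. stage W R \<D> t (Suc k) \<Pi>' Y'"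
proof -
  \<comment> \<open>Both \<open>w\<close> and \<open>v\<close> can only shrink along
    \<open>R\<close>. \<open>S\<close> consists of the remaining points at which neither shrinks any
    more on the way to other remaining points.\<close>
  define w where "w x = {P \<in> \<Pi>. \<exists>y. (x, y) \<in> R \<and> y \<in> P}" for x
  define v where "v x = {\<tau> \<in> t ` W. \<exists>y. (x, y) \<in> R \<and> y \<in> Y \<and> t y = \<tau>}" for x
  define S where "S = {x \<in> Y. \<forall>z\<in>Y. (x, z) \<in> R \<longrightarrow> w z = w x \<and> v z = v x}"
  define cl where "cl = (\<lambda>x. {y \<in> S. t y = t x \<and> w y = w x \<and> v y = v x})"
  define Y' where "Y' = {y \<in> Y. y \<notin> S \<and> (\<forall>z\<in>S. (y, z) \<in> R \<longrightarrow> t z \<noteq> t y)}"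
  define \<Pi>' where "\<Pi>' = \<Pi> \<union> cl ` S"
  have YW: "Y \<subseteq> W" using definable_rest Pow by blast
  have SY: "S \<subseteq> Y" by (auto simp: S_def)
  have tr: "\<And>x y z. (x, y) \<in> R \<Longrightarrow> (y, z) \<in> R \<Longrightarrow> (x, z) \<in> R" using trans by (meson transD)
  have anti: "w y \<subseteq> w x" "v y \<subseteq> v x" if "(x, y) \<in> R" for x y
    using that tr unfolding w_def v_def by blast+
  have fw: "finite (w x)" "finite (v x)" for x using finite_classes fin by (auto simp: w_def v_def)
  \<comment> \<open>Outside \<open>S\<close> some remaining successor has strictly smaller data, so
    the sum of the two cardinalities drops until \<open>S\<close> is reached.\<close>
  have stable: "\<exists>z\<in>S. (y, z) \<in> R" if "y \<in> Y" "y \<notin> S" for y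
    using that
  proof (induction "card (w y) + card (v y)" arbitrary: y rule: less_induct)
    case less
    then obtain z where z: "z \<in> Y" "(y, z) \<in> R" "w z \<noteq> w y \<or> v z \<noteq> v y"
      by (auto simp: S_def)
    then have "w z \<subset> w y \<and> v z \<subseteq> v y \<or> w z \<subseteq> w y \<and> v z \<subset> v y" using anti by blast
    then have "card (w z) + card (v z) < card (w y) + card (v y)"
      using fw by (meson add_le_less_mono add_less_le_mono card_mono psubset_card_mono)
    then show ?case using less.hyps[of z] z tr by blast
  qed
  have S_up: "z \<in> S \<and> w z = w x \<and> v z = v x" if "x \<in> S" "z \<in> Y" "(x, z) \<in> R" for x z
  proof -
    have "w u = w x \<and> v u = v x" if "u \<in> Y" "(z, u) \<in> R" for u
      using \<open>x \<in> S\<close> that tr[OF \<open>(x, z) \<in> R\<close>] by (simp add: S_def)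
    moreover have "w z = w x \<and> v z = v x" using that by (simp add: S_def)
    ultimately show ?thesis using that(2) by (simp add: S_def)
  qed
  have dw: "dfn (\<lambda>x. w x = a)" if "a \<subseteq> \<Pi>" for a
    unfolding w_def using finite_classes definable_classes that by (intro dfn_set_eq dfn_dia dfn_mem) auto
  have dv: "dfn (\<lambda>x. v x = b)" if "b \<subseteq> t ` W" for b
    unfolding v_def using fin definable_rest that dt by (intro dfn_set_eq dfn_dia dfn_conj dfn_mem) auto
  have wP: "w x \<in> Pow \<Pi>" "v x \<in> Pow (t ` W)" for x by (auto simp: w_def v_def)
  \<comment> \<open>The data of two points are to be compared. Running through the finitely many
    possible values \<open>a\<close> and \<open>b\<close> turns this into comparisons with
    constants, which are definable.\<close>
  have dS: "dfn (\<lambda>x. x \<in> S)"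
  proof -
    have "(\<lambda>x. x \<in> S) = (\<lambda>x. x \<in> Y \<and> (\<forall>a\<in>Pow \<Pi>. \<forall>b\<in>Pow (t ` W). w x = a \<and> v x = b \<longrightarrow>
        \<not> (\<exists>z. (x, z) \<in> R \<and> z \<in> Y \<and> \<not> (w z = a \<and> v z = b))))"
      using wP by (auto simp: S_def fun_eq_iff)
    moreover have "dfn \<dots>"
      using definable_rest dw dv finite_classes fin
      by (intro dfn_conj dfn_mem dfn_ball dfn_imp dfn_not dfn_dia) auto
    ultimately show ?thesis by simp
  qed
  have SD: "S \<in> \<D>"
  proof -
    have "{x \<in> W. x \<in> S} = S" using SY YW by blast
    then show ?thesis using dS by (simp add: dfn_def)
  qed
  have clD: "cl x \<in> \<D>" for x
  proof -
    have "cl x = {y \<in> W. y \<in> S \<and> t y = t x \<and> w y = w x \<and> v y = v x}"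
      using SY YW by (auto simp: cl_def)
    moreover have "dfn (\<lambda>y. y \<in> S \<and> t y = t x \<and> w y = w x \<and> v y = v x)"
      using dS dt dw dv wP by (intro dfn_conj) auto
    ultimately show ?thesis by (simp add: dfn_def)
  qed
  have Y'D: "Y' \<in> \<D>"
  proof -
    have "Y' = {y \<in> W. y \<in> Y \<and> y \<notin> S \<and>
        (\<forall>\<tau>\<in>t ` W. t y = \<tau> \<longrightarrow> \<not> (\<exists>z. (y, z) \<in> R \<and> z \<in> S \<and> t z = \<tau>))}"
      using YW by (auto simp: Y'_def)
    moreover have "dfn (\<lambda>y. y \<in> Y \<and> y \<notin> S \<and>
        (\<forall>\<tau>\<in>t ` W. t y = \<tau> \<longrightarrow> \<not> (\<exists>z. (y, z) \<in> R \<and> z \<in> S \<and> t z = \<tau>)))"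
      using fin definable_rest SD dt
      by (intro dfn_conj dfn_ball dfn_imp dfn_not dfn_dia dfn_mem; auto)
    ultimately show ?thesis by (simp add: dfn_def)
  qed
  have cl_S: "cl x \<subseteq> S" for x by (auto simp: cl_def)
  have self: "x \<in> cl x" if "x \<in> S" for x using that by (auto simp: cl_def)
  have Un: "\<Union>\<Pi>' = \<Union>\<Pi> \<union> S" using self cl_S by (auto simp: \<Pi>'_def)
  have f': "finite \<Pi>'"
  proof -
    have "cl ` S \<subseteq> (\<lambda>(\<tau>, a, b). {y \<in> S. t y = \<tau> \<and> w y = a \<and> v y = b}) `
        (t ` W \<times> Pow \<Pi> \<times> Pow (t ` W))"
    proof
      fix c assume "c \<in> cl ` S"
      then obtain x where "x \<in> S" "c = cl x" by blast
      then show "c \<in> (\<lambda>(\<tau>, a, b). {y \<in> S. t y = \<tau> \<and> w y = a \<and> v y = b}) `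
        (t ` W \<times> Pow \<Pi> \<times> Pow (t ` W))"
        using wP[of x] SY YW
        by (intro image_eqI[of _ _ "(t x, w x, v x)"]) (auto simp: cl_def)
    qed
    then have "finite (cl ` S)" by (rule finite_subset) (use fin finite_classes in auto)
    then show ?thesis using finite_classes by (simp add: \<Pi>'_def)
  qed
  have disjoint_classes': "pairwise disjnt \<Pi>'"
  proof -
    have "P \<inter> Q = {}" if "P \<in> \<Pi>'" "Q \<in> \<Pi>'" "P \<noteq> Q" for P Q
    proof -
      have "P \<inter> cl x = {}" if "P \<in> \<Pi>" for P x using that rest_disjoint SY cl_S by blast
      moreover have "cl x \<inter> cl y = {}" if "cl x \<noteq> cl y" for x y
        using that by (auto simp: cl_def)
      moreover have "P \<inter> Q = {}" if "P \<in> \<Pi>" "Q \<in> \<Pi>" "P \<noteq> Q"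
        using that disjoint_classes by (auto simp: pairwise_def disjnt_def)
      ultimately show ?thesis using that unfolding \<Pi>'_def by blast
    qed
    then show ?thesis by (auto simp: pairwise_def disjnt_def)
  qed
  have same_type': "t x = t x'" if "P \<in> \<Pi>'" "x \<in> P" "x' \<in> P" for P x x'
    using that same_type by (auto simp: \<Pi>'_def cl_def)
  have p_morphic': "\<exists>y\<in>Q. (x', y) \<in> R"
    if "P \<in> \<Pi>'" "Q \<in> \<Pi>'" "x \<in> P" "x' \<in> P" "\<exists>y\<in>Q. (x, y) \<in> R" for P Q x x'
  proof (cases "P \<in> \<Pi>")
    case True
    \<comment> \<open>A new class lies inside \<open>Y\<close>, which no old class sees.\<close>
    then have "Q \<in> \<Pi>" using that no_return cl_S SY unfolding \<Pi>'_def by blast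
    then show ?thesis using True p_morphic that by blast
  next
    case False
    then have x: "x \<in> S" "x' \<in> S" "t x = t x'" "w x = w x'" "v x = v x'"
      using that by (auto simp: \<Pi>'_def cl_def)
    show ?thesis
    proof (cases "Q \<in> \<Pi>")
      case True
      then have "Q \<in> w x" using that by (auto simp: w_def)
      then show ?thesis using x by (auto simp: w_def)
    next
      case False
      then obtain q where q: "Q = cl q" using \<open>Q \<in> \<Pi>'\<close> by (auto simp: \<Pi>'_def)
      obtain u where u: "u \<in> cl q" "(x, u) \<in> R" using \<open>\<exists>y\<in>Q. (x, y) \<in> R\<close> q by blast
      then have uS: "u \<in> S" using cl_S by blast
      \<comment> \<open>Since \<open>u\<close> is in \<open>Y\<close>, also \<open>x'\<close> sees a
        point \<open>u'\<close> of \<open>Y\<close> with the type of \<open>u\<close>. As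
        \<open>x\<close> and \<open>x'\<close> are in \<open>S\<close> and share their data,
        \<open>u\<close> and \<open>u'\<close> are in \<open>S\<close> with these same data, hence
        in one class.\<close>
      then have "t u \<in> v x'" unfolding \<open>v x = v x'\<close>[symmetric] using u SY YW by (auto simp: v_def)
      then obtain u' where u': "(x', u') \<in> R" "u' \<in> Y" "t u' = t u" by (auto simp: v_def)
      have "u' \<in> S" "w u' = w u" "v u' = v u"
        using S_up[OF x(2) u'(2,1)] S_up[OF x(1) _ u(2)] uS SY x(4,5) by auto
      then have "u' \<in> Q" using u u' q by (auto simp: cl_def)
      then show ?thesis using u' by blast
    qed
  qed
  have discarded': "\<exists>z\<in>\<Union>\<Pi>'. (y, z) \<in> R \<and> t z = t y" if "y \<in> W" "y \<notin> Y'" "y \<notin> \<Union>\<Pi>'" for y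
    using that discarded[of y] unfolding Un Y'_def by blast
  have new_type': "t z \<noteq> t y" if "y \<in> Y'" "z \<in> \<Union>\<Pi>'" "(y, z) \<in> R" for y z
    using that new_type unfolding Un Y'_def by blast
  have no_return': "(x, y) \<notin> R" if "x \<in> \<Union>\<Pi>'" "y \<in> Y'" for x y
    using that no_return S_up unfolding Un Y'_def by blast
  have many_types': "Suc k \<le> card (t ` {z \<in> \<Union>\<Pi>'. (y, z) \<in> R})" if "y \<in> Y'" for y
  proof -
    \<comment> \<open>The point \<open>z\<close> of \<open>S\<close> sees at least \<open>k\<close>
      selected types, none of them its own by \<open>new_type\<close>. By transitivity
      \<open>y\<close> sees these and also the newly selected \<open>z\<close>: one type
      more.\<close>
    obtain z where z: "z \<in> S" "(y, z) \<in> R" using stable[of y] \<open>y \<in> Y'\<close> by (auto simp: Y'_def)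
    let ?T = "t ` {u \<in> \<Union>\<Pi>. (z, u) \<in> R}"
    have fT: "finite (t ` X)" if "X \<subseteq> W" for X using that fin by (meson finite_subset image_mono)
    have W': "\<Union>\<Pi>' \<subseteq> W" "\<Union>\<Pi> \<subseteq> W" using Un definable_classes SY YW Pow by blast+
    have "t z \<notin> ?T" using new_type z SY by fastforce
    moreover have "finite ?T" by (rule fT) (use W' in blast)
    moreover have "k \<le> card ?T" using many_types z SY by blast
    ultimately have "Suc k \<le> card (insert (t z) ?T)" by simp
    also have "insert (t z) ?T \<subseteq> t ` {z \<in> \<Union>\<Pi>'. (y, z) \<in> R}"
      using z tr[OF z(2)] unfolding Un by auto
    then have "card (insert (t z) ?T) \<le> card (t ` {z \<in> \<Union>\<Pi>'. (y, z) \<in> R})"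
      by (intro card_mono fT) (use W' in auto)
    finally show ?thesis .
  qed
  have D': "\<Pi>' \<subseteq> \<D>" using definable_classes clD by (auto simp: \<Pi>'_def)
  have rest_disjoint': "Y' \<inter> \<Union>\<Pi>' = {}" using rest_disjoint unfolding Un Y'_def by blast
  have "stage W R \<D> t (Suc k) \<Pi>' Y'"
    by unfold_locales (fact f' D' Y'D disjoint_classes' rest_disjoint' same_type' p_morphic' discarded' new_type' no_return' many_types')+
  then show ?thesis by blast
qed

end

context general_frame
begin

text \<open>Initially there are no classes and all points remain. After one stage more than there
  are types, a remaining point would see more types than exist; so every unselected point is a
  discarded one.\<close>

lemma definable_partition:
  assumes fin: "finite (t ` W)" and dt: "\<And>\<tau>. dfn (\<lambda>x. t x = \<tau>)"
  obtains \<Pi> where "finite \<Pi>" "\<Pi> \<subseteq> \<D>" "pairwise disjnt \<Pi>"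
    and "\<And>P x x'. P \<in> \<Pi> \<Longrightarrow> x \<in> P \<Longrightarrow> x' \<in> P \<Longrightarrow> t x = t x'"
    and "\<And>P Q x x'. P \<in> \<Pi> \<Longrightarrow> Q \<in> \<Pi> \<Longrightarrow> x \<in> P \<Longrightarrow> x' \<in> P \<Longrightarrow> \<exists>y\<in>Q. (x, y) \<in> R \<Longrightarrow>
      \<exists>y\<in>Q. (x', y) \<in> R"
    and "\<And>y. y \<in> W \<Longrightarrow> y \<notin> \<Union>\<Pi> \<Longrightarrow> \<exists>z\<in>\<Union>\<Pi>. (y, z) \<in> R \<and> t z = t y"
proof -
  have "\<exists>\<Pi> Y. stage W R \<D> t k \<Pi> Y" for k
  proof (induction k)
    case 0
    have "stage W R \<D> t 0 {} W" using top by unfold_locales auto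
    then show ?case by blast
  next
    case (Suc k)
    then show ?case using stage.step[OF _ fin dt] by blast
  qed
  then obtain \<Pi> Y where "stage W R \<D> t (Suc (card (t ` W))) \<Pi> Y" by blast
  then interpret st: stage W R \<D> t "Suc (card (t ` W))" \<Pi> Y .
  have "\<Union>\<Pi> \<subseteq> W" using st.definable_classes Pow by blast
  then have "card (t ` {z \<in> \<Union>\<Pi>. (y, z) \<in> R}) \<le> card (t ` W)" for y
    using fin by (intro card_mono) auto
  then have "y \<notin> Y" for y using st.many_types[of y] by (meson Suc_n_not_le_n le_trans)
  then show thesis
    by (intro that[OF st.finite_classes st.definable_classes st.disjoint_classes st.same_type st.p_morphic st.discarded])
qed

end

section \<open>Refutation of canonical formulas\<close>

text \<open>A point of a refuting model is mapped to \<open>a\<^sub>i\<close> when it falsifies \<open>p\<^sub>i\<close>, and it is outside the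
  domain of the subreduction when it falsifies none of the \<open>p\<^sub>i\<close>.\<close>

definition pts :: "nat \<Rightarrow> ('w \<Rightarrow> nat \<Rightarrow> bool) \<Rightarrow> 'w \<Rightarrow> nat set" where
  "pts n V y = {i. i \<le> n \<and> \<not> V y i}"

definition seen :: "nat \<Rightarrow> ('w \<times> 'w) set \<Rightarrow> ('w \<Rightarrow> nat \<Rightarrow> bool) \<Rightarrow> 'w \<Rightarrow> nat set" where
  "seen n R V y = (\<Union>z\<in>R `` {y}. pts n V z)"

lemma sat_Box_Var: "i \<le> n \<Longrightarrow> sat R V y (\<box> Var i) \<longleftrightarrow> i \<notin> seen n R V y"
  by (auto simp: seen_def pts_def)

lemma sat_Var_pts: "i \<le> n \<Longrightarrow> sat R V y (Var i) \<longleftrightarrow> i \<notin> pts n V y"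
  by (simp add: pts_def)

lemma pts_le: "i \<in> pts n V y \<Longrightarrow> i \<le> n"
  by (simp add: pts_def)

lemma seen_le: "i \<in> seen n R V y \<Longrightarrow> i \<le> n"
  by (auto simp: seen_def pts_def)

lemma set_upt_atMost: "set [0..<Suc n] = {..n}"
  by (simp only: set_upt atLeast0LessThan lessThan_Suc_atMost)

lemma set_subseqs: "set ` set (subseqs [0..<Suc n]) = Pow {..n}"
  by (simp only: subseqs_powset set_upt_atMost)

lemma sat_Conj_filter:
  "sat R V x (Conj [f i. i \<leftarrow> xs, P i]) \<longleftrightarrow> (\<forall>i\<in>set xs. P i \<longrightarrow> sat R V x (f i))"
  by auto

lemma sat_Disj_filter:
  "sat R V x (Disj [f i. i \<leftarrow> xs, P i]) \<longleftrightarrow> (\<exists>i\<in>set xs. P i \<and> sat R V x (f i))"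
  by auto

lemma sat_Conj_map: "sat R V x (Conj (map f xs)) \<longleftrightarrow> (\<forall>i\<in>set xs. sat R V x (f i))"
  by simp

lemma sat_Conj_Box:
  "sat R V y (Conj [\<box> Var k. k \<leftarrow> [0..<Suc n], P k]) \<longleftrightarrow> seen n R V y \<subseteq> {k. \<not> P k}"
proof -
  have "sat R V y (Conj [\<box> Var k. k \<leftarrow> [0..<Suc n], P k]) \<longleftrightarrow>
      (\<forall>k\<in>{..n}. P k \<longrightarrow> k \<notin> seen n R V y)"
    unfolding sat_Conj_filter set_upt_atMost by (auto simp: sat_Box_Var simp del: sat.simps(6))
  then show ?thesis using seen_le[of _ n R V y] by auto
qed

lemma sat_Conj_Var:
  "sat R V y (Conj [Var j. j \<leftarrow> [0..<Suc n]]) \<longleftrightarrow> pts n V y = {}"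
  unfolding sat_Conj_map set_upt_atMost by (auto simp: pts_def)

lemma sat_phi_rel:
  assumes "i \<le> n" "j \<le> n"
  shows "sat R V x (phi_rel i j) \<longleftrightarrow>
    (\<forall>y. (x, y) \<in> R\<^sup>= \<longrightarrow> i \<in> pts n V y \<longrightarrow> j \<in> seen n R V y)"
  unfolding phi_rel_def sat_Boxp sat.simps(4) sat_Box_Var[OF assms(2)] sat_Var_pts[OF assms(1)]
  by blast

text \<open>Where \<open>Var i\<close> is false, the inner implication holds only if its antecedent
  fails; so the formula forces that antecedent wherever \<open>Var i\<close> is false.\<close>

lemma sat_phi_pt:
  assumes "i \<le> n"
  shows "sat R V x (phi_pt n F i) \<longleftrightarrow>
    (\<forall>y. (x, y) \<in> R\<^sup>= \<longrightarrow> i \<in> pts n V y \<longrightarrow> seen n R V y \<subseteq> F `` {i} \<and> pts n V y = {i})"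
proof -
  have vars: "sat R V y (Conj [Var j. j \<leftarrow> [0..<Suc n], j \<noteq> i]) \<longleftrightarrow> pts n V y \<subseteq> {i}" for y
    unfolding sat_Conj_filter set_upt_atMost by (auto simp: pts_def)
  have "{k. \<not> (i, k) \<notin> F} = F `` {i}" by auto
  then show ?thesis
    unfolding phi_pt_def sat_Boxp sat.simps(2,4) sat_Conj_Box vars sat_Var_pts[OF assms] by auto
qed

text \<open>This is the closed domain condition: a point that sees all of \<open>d\<close>, and
  nothing outside the upward closure of \<open>d\<close>, must belong to the domain.\<close>

lemma sat_phi_dom:
  assumes "d \<subseteq> {..n}"
  shows "sat R V x (phi_dom n F d) \<longleftrightarrow>
    (\<forall>y. (x, y) \<in> R\<^sup>= \<longrightarrow> seen n R V y \<subseteq> upc F d \<longrightarrow> pts n V y = {} \<longrightarrow>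
      \<not> d \<subseteq> seen n R V y)"
proof -
  have disj: "sat R V y (Disj [\<box> Var j. j \<leftarrow> [0..<Suc n], j \<in> d]) \<longleftrightarrow>
      \<not> d \<subseteq> seen n R V y" for y
  proof -
    have "sat R V y (Disj [\<box> Var j. j \<leftarrow> [0..<Suc n], j \<in> d]) \<longleftrightarrow>
      (\<exists>k\<in>{..n}. k \<in> d \<and> k \<notin> seen n R V y)"
      unfolding sat_Disj_filter set_upt_atMost by (auto simp: sat_Box_Var simp del: sat.simps(6))
    then show ?thesis using assms by auto
  qed
  have "{k. \<not> k \<notin> upc F d} = upc F d" by simp
  then show ?thesis
    unfolding phi_dom_def sat_Boxp sat.simps(2,4) sat_Conj_Box sat_Conj_Var disj by auto
qed

text \<open>This is cofinality: every point is in the domain or sees a point of it.\<close>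

lemma sat_phi_bot:
  "sat R V x (phi_bot n) \<longleftrightarrow>
    (\<forall>y. (x, y) \<in> R\<^sup>= \<longrightarrow> pts n V y \<noteq> {} \<or> seen n R V y \<noteq> {})"
proof -
  have "sat R V y (Conj [\<box>\<^sup>+ Var i. i \<leftarrow> [0..<Suc n]]) \<longleftrightarrow>
      pts n V y = {} \<and> seen n R V y = {}" for y
    unfolding sat_Conj_map set_upt_atMost by (auto simp: pts_def seen_def)
  then show ?thesis unfolding phi_bot_def sat_Boxp sat.simps(4) by simp
qed

text \<open>A refutation at \<open>x\<close> is a cofinal subreduction of the part above
  \<open>x\<close> to \<open>F\<close>, sending \<open>x\<close> to the root and respecting the
  closed domains \<open>D\<close>. The inclusions from \<open>phi_rel\<close> and
  \<open>phi_pt\<close> combine to the equation for \<open>seen\<close>.\<close>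

lemma not_sat_alpha_bot:
  assumes F: "F \<subseteq> {..n} \<times> {..n}" and D: "\<And>d. d \<in> D \<Longrightarrow> d \<subseteq> {..n}"
  shows "\<not> sat R V x (alpha_bot n F D) \<longleftrightarrow> 0 \<in> pts n V x \<and> (\<forall>y. (x, y) \<in> R\<^sup>= \<longrightarrow>
    (\<forall>i\<in>pts n V y. seen n R V y = F `` {i} \<and> pts n V y = {i}) \<and>
    (\<forall>d\<in>D. seen n R V y \<subseteq> upc F d \<longrightarrow> pts n V y = {} \<longrightarrow> \<not> d \<subseteq> seen n R V y) \<and>
    (pts n V y \<noteq> {} \<or> seen n R V y \<noteq> {}))"
proof -
  have rel: "sat R V x (Conj [phi_rel i j. i \<leftarrow> [0..<Suc n], j \<leftarrow> [0..<Suc n], (i, j) \<in> F]) \<longleftrightarrow>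
      (\<forall>y. (x, y) \<in> R\<^sup>= \<longrightarrow> (\<forall>i\<in>pts n V y. F `` {i} \<subseteq> seen n R V y))"
  proof -
    have "sat R V x (Conj [phi_rel i j. i \<leftarrow> [0..<Suc n], j \<leftarrow> [0..<Suc n], (i, j) \<in> F]) \<longleftrightarrow>
      (\<forall>i\<in>set [0..<Suc n]. \<forall>j\<in>set [0..<Suc n]. (i, j) \<in> F \<longrightarrow> sat R V x (phi_rel i j))"
      by (auto simp del: upt_Suc)
    also have "\<dots> \<longleftrightarrow> (\<forall>i j. (i, j) \<in> F \<longrightarrow> sat R V x (phi_rel i j))"
      unfolding set_upt_atMost using F by blast
    also have "\<dots> \<longleftrightarrow> (\<forall>i j. (i, j) \<in> F \<longrightarrow>
        (\<forall>y. (x, y) \<in> R\<^sup>= \<longrightarrow> i \<in> pts n V y \<longrightarrow> j \<in> seen n R V y))"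
    proof -
      have "sat R V x (phi_rel i j) \<longleftrightarrow>
        (\<forall>y. (x, y) \<in> R\<^sup>= \<longrightarrow> i \<in> pts n V y \<longrightarrow> j \<in> seen n R V y)" if "(i, j) \<in> F" for i j
        by (rule sat_phi_rel) (use that F in auto)
      then show ?thesis by simp
    qed
    also have "\<dots> \<longleftrightarrow> (\<forall>y. (x, y) \<in> R\<^sup>= \<longrightarrow> (\<forall>i\<in>pts n V y. F `` {i} \<subseteq> seen n R V y))"
      unfolding subset_iff Image_singleton_iff by blast
    finally show ?thesis .
  qed
  have pt: "sat R V x (Conj [phi_pt n F i. i \<leftarrow> [0..<Suc n]]) \<longleftrightarrow>
      (\<forall>y. (x, y) \<in> R\<^sup>= \<longrightarrow> (\<forall>i\<in>pts n V y. seen n R V y \<subseteq> F `` {i} \<and> pts n V y = {i}))"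
  proof -
    have "sat R V x (Conj [phi_pt n F i. i \<leftarrow> [0..<Suc n]]) \<longleftrightarrow> (\<forall>i\<le>n. \<forall>y. (x, y) \<in> R\<^sup>= \<longrightarrow>
        i \<in> pts n V y \<longrightarrow> seen n R V y \<subseteq> F `` {i} \<and> pts n V y = {i})"
      unfolding sat_Conj_map set_upt_atMost by (simp add: sat_phi_pt Ball_def)
    then show ?thesis using pts_le[of _ n V] by blast
  qed
  have dom: "sat R V x (Conj [phi_dom n F d. d \<leftarrow> map set (subseqs [0..<Suc n]), d \<in> D]) \<longleftrightarrow>
      (\<forall>y. (x, y) \<in> R\<^sup>= \<longrightarrow> (\<forall>d\<in>D. seen n R V y \<subseteq> upc F d \<longrightarrow> pts n V y = {} \<longrightarrow>
        \<not> d \<subseteq> seen n R V y))"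
  proof -
    have "sat R V x (Conj [phi_dom n F d. d \<leftarrow> map set (subseqs [0..<Suc n]), d \<in> D]) \<longleftrightarrow>
      (\<forall>d\<in>Pow {..n}. d \<in> D \<longrightarrow> sat R V x (phi_dom n F d))"
      unfolding sat_Conj_filter set_map set_subseqs ..
    also have "\<dots> \<longleftrightarrow> (\<forall>d\<in>D. sat R V x (phi_dom n F d))" using D by blast
    also have "\<dots> \<longleftrightarrow> (\<forall>d\<in>D. \<forall>y. (x, y) \<in> R\<^sup>= \<longrightarrow> seen n R V y \<subseteq> upc F d \<longrightarrow>
        pts n V y = {} \<longrightarrow> \<not> d \<subseteq> seen n R V y)"
      by (simp only: sat_phi_dom[OF D] cong: ball_cong)
    finally show ?thesis by meson
  qed
  have eq: "(\<forall>i\<in>P. S = F `` {i} \<and> P = {i}) \<longleftrightarrow>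
      (\<forall>i\<in>P. F `` {i} \<subseteq> S) \<and> (\<forall>i\<in>P. S \<subseteq> F `` {i} \<and> P = {i})" for P S
    unfolding set_eq_subset[of S] by meson
  have "\<not> sat R V x (Var 0) \<longleftrightarrow> 0 \<in> pts n V x" by (simp add: pts_def)
  then show ?thesis
    unfolding alpha_bot_def sat.simps(2,4) rel pt dom sat_phi_bot eq by meson
qed

section \<open>Pulling back a finite countermodel\<close>

text \<open>Take a generating set of least cardinality: if one member saw another, the latter could
  be dropped by transitivity. This covers clusters too.\<close>

lemma upset_antichain:
  assumes "finite U" "U \<noteq> {}" "F `` U \<subseteq> U" "trans F"
  obtains d where "d \<noteq> {}" "d \<subseteq> U" "upc F d = U" "\<forall>a\<in>d. \<forall>b\<in>d. (a, b) \<in> F \<longrightarrow> a = b"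
proof -
  let ?P = "\<lambda>d. d \<subseteq> U \<and> upc F d = U"
  have "?P U" using assms(3) by (auto simp: upc_def)
  then obtain d where d: "?P d" "\<And>e. ?P e \<Longrightarrow> card d \<le> card e"
    using ex_has_least_nat[of ?P U card] by auto
  have "a = b" if "a \<in> d" "b \<in> d" "(a, b) \<in> F" for a b
  proof (rule ccontr)
    assume "a \<noteq> b"
    have "upc F d \<subseteq> upc F (d - {b})"
      using that \<open>a \<noteq> b\<close> transD[OF \<open>trans F\<close>] unfolding upc_def by blast
    then have "?P (d - {b})" using d(1) by (auto simp: upc_def)
    then have "card d \<le> card (d - {b})" by (rule d(2))
    moreover have "card (d - {b}) < card d"
      using that(2) d(1) assms(1) by (meson card_Diff1_less finite_subset)
    ultimately show False by simp
  qed
  moreover have "d \<noteq> {}" using d(1) assms(2) by (auto simp: upc_def)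
  ultimately show thesis using d(1) that by blast
qed

text \<open>A point outside the domain that sees exactly \<open>U\<close> may be given the valuation of \<open>a\<close>.\<close>

definition fits :: "(nat \<times> nat) set \<Rightarrow> (nat \<Rightarrow> nat \<Rightarrow> bool) \<Rightarrow> fm \<Rightarrow> nat set \<Rightarrow> nat \<Rightarrow> bool" where
  "fits F V A U a \<longleftrightarrow> a \<in> U \<and>
     (\<forall>B. \<box> B \<in> subfms A \<longrightarrow> sat F V a (\<box> B) \<longrightarrow> (\<forall>u\<in>U. sat F V u B))"

text \<open>For these antichains no valuation is on offer at a point outside the domain that sees
  exactly the upward closure, so such points must be forbidden.\<close>

definition closed_domains :: "nat \<Rightarrow> (nat \<times> nat) set \<Rightarrow> (nat \<Rightarrow> nat \<Rightarrow> bool) \<Rightarrow> fm \<Rightarrow> nat set set" where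
  "closed_domains n F V A = {d. is_antichain n F d \<and> \<not> (\<exists>a. fits F V A (upc F d) a)}"

text \<open>The first disjuncts copy \<open>V\<close> to points of the domain. Each later one
  describes a point outside that sees exactly \<open>U\<close> and gives it the valuation of a
  chosen fitting point. If nothing fits \<open>U\<close>, the choice is arbitrary; no point above a
  refutation is then described by \<open>U\<close>.\<close>

definition pull_back :: "nat \<Rightarrow> (nat \<times> nat) set \<Rightarrow> (nat \<Rightarrow> nat \<Rightarrow> bool) \<Rightarrow> fm \<Rightarrow> nat \<Rightarrow> fm" where
  "pull_back n F V A q = Disj
     ([\<^bold>\<sim> Var i. i \<leftarrow> [0..<Suc n], V i q] @
      [Conj ([Var i. i \<leftarrow> [0..<Suc n]] @ [\<^bold>\<sim> \<box> Var i. i \<leftarrow> [0..<Suc n], i \<in> U] @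
             [\<box> Var i. i \<leftarrow> [0..<Suc n], i \<notin> U]).
       U \<leftarrow> map set (subseqs [0..<Suc n]), V (SOME a. fits F V A U a) q])"

lemma sat_pull_back:
  "sat R W y (pull_back n F V A q) \<longleftrightarrow>
    (\<exists>i\<in>pts n W y. V i q) \<or> pts n W y = {} \<and> V (SOME a. fits F V A (seen n R W y) a) q"
proof -
  let ?C = "\<lambda>U. Conj ([Var i. i \<leftarrow> [0..<Suc n]] @ [\<^bold>\<sim> \<box> Var i. i \<leftarrow> [0..<Suc n], i \<in> U] @
             [\<box> Var i. i \<leftarrow> [0..<Suc n], i \<notin> U])"
  have C: "sat R W y (?C U) \<longleftrightarrow> pts n W y = {} \<and> seen n R W y = U" if "U \<in> Pow {..n}" for U
  proof -
    have app: "sat R W y (Conj (as @ bs)) \<longleftrightarrow> sat R W y (Conj as) \<and> sat R W y (Conj bs)" for as bs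
      by auto
    have "sat R W y (Conj [\<^bold>\<sim> \<box> Var i. i \<leftarrow> [0..<Suc n], i \<in> U]) \<longleftrightarrow> U \<subseteq> seen n R W y"
    proof -
      have "sat R W y (Conj [\<^bold>\<sim> \<box> Var i. i \<leftarrow> [0..<Suc n], i \<in> U]) \<longleftrightarrow>
          (\<forall>i\<in>{..n}. i \<in> U \<longrightarrow> i \<in> seen n R W y)"
        unfolding sat_Conj_filter set_upt_atMost by (auto simp: sat_Box_Var simp del: sat.simps(6))
      then show ?thesis using that by auto
    qed
    then show ?thesis unfolding app sat_Conj_Var sat_Conj_Box by auto
  qed
  have app: "sat R W y (Disj (as @ bs)) \<longleftrightarrow> sat R W y (Disj as) \<or> sat R W y (Disj bs)" for as bs
    by auto
  have "sat R W y (pull_back n F V A q) \<longleftrightarrow>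
      (\<exists>i\<in>{..n}. V i q \<and> \<not> W y i) \<or>
      (\<exists>U\<in>Pow {..n}. V (SOME a. fits F V A U a) q \<and> sat R W y (?C U))"
    unfolding pull_back_def app sat_Disj_filter set_map set_subseqs set_upt_atMost by simp
  also have "\<dots> \<longleftrightarrow> (\<exists>i\<in>pts n W y. V i q) \<or>
      (\<exists>U\<in>Pow {..n}. V (SOME a. fits F V A U a) q \<and> pts n W y = {} \<and> seen n R W y = U)"
    using C by (auto simp: pts_def)
  also have "\<dots> \<longleftrightarrow> (\<exists>i\<in>pts n W y. V i q) \<or>
      pts n W y = {} \<and> V (SOME a. fits F V A (seen n R W y) a) q"
    using seen_le[of _ n R W y] by auto
  finally show ?thesis .
qed

text \<open>Above \<open>x\<close>, every point agrees with its representative in the finite model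
  on all subformulas of \<open>A\<close>. Only transitivity of \<open>R\<close> enters, so the
  result can be used in the canonical model of K4.\<close>

lemma pull_back_refutes:
  assumes F: "rooted_frame n F" and A: "\<not> sat F V 0 A" and R: "trans R"
    and ref: "\<not> sat R W x (alpha_bot n F (closed_domains n F V A))"
  shows "\<not> sat R W x (subst (pull_back n F V A) A)"
proof -
  \<comment> \<open>Outside the domain this is the very choice made in \<open>pull_back\<close>, so
    the substitution evaluates to \<open>V (rep y)\<close>.\<close>
  define rep where "rep y = (if pts n W y = {} then SOME a. fits F V A (seen n R W y) a
    else SOME i. i \<in> pts n W y)" for y
  have Fn: "F \<subseteq> {..n} \<times> {..n}" and tF: "trans F" using F by (auto simp: rooted_frame_def)
  have "d \<subseteq> {..n}" if "d \<in> closed_domains n F V A" for d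
    using that by (auto simp: closed_domains_def is_antichain_def)
  note ref = iffD1[OF not_sat_alpha_bot[OF Fn this] ref]
  have root: "0 \<in> pts n W x" using ref by blast
  have pt: "seen n R W y = F `` {i}" "pts n W y = {i}" if "(x, y) \<in> R\<^sup>=" "i \<in> pts n W y" for y i
    using ref that by blast+
  have dom: "\<not> d \<subseteq> seen n R W y"
    if "(x, y) \<in> R\<^sup>=" "d \<in> closed_domains n F V A" "seen n R W y \<subseteq> upc F d" "pts n W y = {}" for y d
    using ref that by blast
  have bot: "seen n R W y \<noteq> {}" if "(x, y) \<in> R\<^sup>=" "pts n W y = {}" for y
    using ref that by blast
  have up: "(x, z) \<in> R\<^sup>=" if "(x, y) \<in> R\<^sup>=" "(y, z) \<in> R" for y z
    using that transD[OF R] by blast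
  have anti: "seen n R W z \<subseteq> seen n R W y" if "(y, z) \<in> R" for y z
    using that transD[OF R] unfolding seen_def by blast
  have seen_up: "F `` seen n R W y \<subseteq> seen n R W y" if y: "(x, y) \<in> R\<^sup>=" for y
  proof
    fix j assume "j \<in> F `` seen n R W y"
    then obtain i z where "(y, z) \<in> R" "i \<in> pts n W z" "(i, j) \<in> F" by (auto simp: seen_def)
    then show "j \<in> seen n R W y" using pt(1)[OF up[OF y]] anti by blast
  qed
  have rep_pt: "rep y = i" if "(x, y) \<in> R\<^sup>=" "i \<in> pts n W y" for y i
    using pt(2)[OF that] by (simp add: rep_def)
  have rep_out: "fits F V A (seen n R W y) (rep y)" if y: "(x, y) \<in> R\<^sup>=" "pts n W y = {}" for y
  proof -
    \<comment> \<open>The set seen is nonempty by cofinality and closed upward, hence generated by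
      an antichain \<open>d\<close>. Were \<open>d\<close> a closed domain, \<open>y\<close> would
      violate its condition; so some point fits.\<close>
    have "finite (seen n R W y)" by (rule finite_subset[of _ "{..n}"]) (auto dest: seen_le)
    then obtain d where d: "d \<noteq> {}" "d \<subseteq> seen n R W y" "upc F d = seen n R W y"
        "\<forall>a\<in>d. \<forall>b\<in>d. (a, b) \<in> F \<longrightarrow> a = b"
      using upset_antichain[OF _ bot[OF y] seen_up[OF y(1)] tF] by blast
    have "is_antichain n F d" using d seen_le[of _ n R W y] by (auto simp: is_antichain_def)
    moreover have "d \<notin> closed_domains n F V A" using dom[OF y(1) _ _ y(2)] d by blast
    ultimately have "\<exists>a. fits F V A (seen n R W y) a" using d(3) by (auto simp: closed_domains_def)
    then show ?thesis using y(2) by (simp add: rep_def someI_ex)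
  qed
  \<comment> \<open>A successor outside the domain adds nothing new: its representative is among the
    points it sees, which \<open>y\<close> sees as well.\<close>
  have reps: "rep ` (R `` {y}) = seen n R W y" if y: "(x, y) \<in> R\<^sup>=" for y
  proof
    show "rep ` (R `` {y}) \<subseteq> seen n R W y"
    proof clarify
      fix z assume z: "(y, z) \<in> R"
      note xz = up[OF y z]
      show "rep z \<in> seen n R W y"
      proof (cases "pts n W z = {}")
        case True
        then show ?thesis using rep_out[OF xz] anti[OF z] by (auto simp: fits_def)
      next
        case False
        then obtain i where "i \<in> pts n W z" by blast
        then show ?thesis using rep_pt[OF xz] z by (auto simp: seen_def)
      qed
    qed
    show "seen n R W y \<subseteq> rep ` (R `` {y})"
      using rep_pt[OF up[OF y]] unfolding seen_def by force
  qed
  have "sat R (\<lambda>y. V (rep y)) y B \<longleftrightarrow> sat F V (rep y) B" if "(x, y) \<in> R\<^sup>=" "B \<in> subfms A" for y B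
    using that
  proof (induction B arbitrary: y)
    case (Box B)
    note y = Box.prems(1)
    have "sat R (\<lambda>y. V (rep y)) y (\<box> B) \<longleftrightarrow> (\<forall>u\<in>rep ` (R `` {y}). sat F V u B)"
      using Box.IH[OF up[OF y] subfms_Box[OF Box.prems(2)]] by auto
    also have "\<dots> \<longleftrightarrow> (\<forall>u\<in>seen n R W y. sat F V u B)" unfolding reps[OF y] ..
    \<comment> \<open>Outside the domain, one direction is part of \<open>fits\<close>; the other
      holds because all successors of \<open>rep y\<close> are among the points seen.\<close>
    also have "\<dots> \<longleftrightarrow> sat F V (rep y) (\<box> B)"
    proof (cases "pts n W y = {}")
      case True
      note fit = rep_out[OF y True]
      have "F `` {rep y} \<subseteq> seen n R W y" using fit seen_up[OF y] by (auto simp: fits_def)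
      then show ?thesis using fit Box.prems(2) by (auto simp: fits_def)
    next
      case False
      then obtain i where "i \<in> pts n W y" by blast
      then show ?thesis using rep_pt[OF y] pt(1)[OF y] by auto
    qed
    finally show ?case .
  next
    case (And B C)
    show ?case using And.IH[OF And.prems(1)] subfms_trans[OF And.prems(2)]
        subfms_refl[of B] subfms_refl[of C] by auto
  next
    case (Or B C)
    show ?case using Or.IH[OF Or.prems(1)] subfms_trans[OF Or.prems(2)]
        subfms_refl[of B] subfms_refl[of C] by auto
  next
    case (Imp B C)
    show ?case using Imp.IH[OF Imp.prems(1)] subfms_trans[OF Imp.prems(2)]
        subfms_refl[of B] subfms_refl[of C] by auto
  next
    case (Tilde B)
    show ?case using Tilde.IH[OF Tilde.prems(1)] subfms_trans[OF Tilde.prems(2)]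
        subfms_refl[of B] by auto
  qed simp
  moreover have "rep x = 0" using rep_pt[OF _ root] by simp
  ultimately have "\<not> sat R (\<lambda>y. V (rep y)) x A" using A subfms_refl by simp
  moreover have "sat R W y (pull_back n F V A q) \<longleftrightarrow> V (rep y) q" if "(x, y) \<in> R\<^sup>=" for y q
  proof (cases "pts n W y = {}")
    case True
    then show ?thesis by (simp add: sat_pull_back rep_def)
  next
    case False
    then obtain i where "i \<in> pts n W y" by blast
    then show ?thesis using rep_pt[OF that] pt(2)[OF that, of i] by (simp add: sat_pull_back)
  qed
  then have "sat R (\<lambda>y q. sat R W y (pull_back n F V A q)) x A \<longleftrightarrow> sat R (\<lambda>y. V (rep y)) x A"
    by (intro sat_cong[of "{y. (x, y) \<in> R\<^sup>=}"]) (use up in auto)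
  ultimately show ?thesis unfolding sat_subst by simp
qed

section \<open>Canonical formulas refuted in a logic\<close>

lemma (in general_frame) canonical_refutation:
  fixes U :: "'w \<Rightarrow> nat \<Rightarrow> bool"
  assumes dU: "\<And>B. dfn (\<lambda>x. sat R U x B)" and X: "X \<in> W" "\<not> sat R U X A"
  obtains n F V e x where "rooted_frame n F" "\<not> sat F V 0 A" "x \<in> W" "\<And>i. e i \<in> \<D>"
    "\<not> sat R (\<lambda>y i. y \<notin> e i) x (alpha_bot n F (closed_domains n F V A))"
proof -
  define t where "t y = {B \<in> subfms A. sat R U y B}" for y
  have finT: "finite (t ` W)"
    by (rule finite_subset[of _ "Pow (subfms A)"]) (auto simp: t_def finite_subfms)
  have dfnT: "dfn (\<lambda>y. t y = \<tau>)" for \<tau>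
  proof (cases "\<tau> \<subseteq> subfms A")
    case True
    show ?thesis unfolding t_def by (rule dfn_set_eq[OF finite_subfms dU True])
  next
    case False
    then have "(\<lambda>y. t y = \<tau>) = (\<lambda>y. False)" by (auto simp: t_def)
    then show ?thesis using dfn_const[of False] by simp
  qed
  obtain \<Pi> where fin: "finite \<Pi>" and PD: "\<Pi> \<subseteq> \<D>" and dis: "pairwise disjnt \<Pi>"
    and tc: "\<And>P y y'. P \<in> \<Pi> \<Longrightarrow> y \<in> P \<Longrightarrow> y' \<in> P \<Longrightarrow> t y = t y'"
    and pm: "\<And>P Q y y'. P \<in> \<Pi> \<Longrightarrow> Q \<in> \<Pi> \<Longrightarrow> y \<in> P \<Longrightarrow> y' \<in> P \<Longrightarrow> \<exists>z\<in>Q. (y, z) \<in> R \<Longrightarrow>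
      \<exists>z\<in>Q. (y', z) \<in> R"
    and disc: "\<And>y. y \<in> W \<Longrightarrow> y \<notin> \<Union>\<Pi> \<Longrightarrow> \<exists>z\<in>\<Union>\<Pi>. (y, z) \<in> R \<and> t z = t y"
    by (rule definable_partition[OF finT dfnT], rule that)
  have t_sat: "sat R U y B \<longleftrightarrow> sat R U y' B" if "t y = t y'" "B \<in> subfms A" for y y' B
    using that unfolding t_def by blast
  have tr: "\<And>a b c. (a, b) \<in> R \<Longrightarrow> (b, c) \<in> R \<Longrightarrow> (a, c) \<in> R" using trans by (meson transD)
  have RW: "\<And>a b. (a, b) \<in> R \<Longrightarrow> a \<in> W \<and> b \<in> W" using R by blast
  have PW: "P \<subseteq> W" if "P \<in> \<Pi>" for P using that PD Pow by blast
  \<comment> \<open>If \<open>X\<close> was discarded, a selected point of its type refutes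
    \<open>A\<close> in its place.\<close>
  have "\<exists>x\<in>\<Union>\<Pi>. t x = t X"
  proof (cases "X \<in> \<Union>\<Pi>")
    case True
    then show ?thesis by blast
  next
    case False
    then show ?thesis using disc[OF X(1)] by blast
  qed
  then obtain x P0 where P0: "P0 \<in> \<Pi>" "x \<in> P0" "t x = t X" by blast
  have xA: "\<not> sat R U x A" using t_sat[OF P0(3) subfms_refl] X(2) by simp
  \<comment> \<open>Only classes seen from \<open>x\<close> are kept, and the class of
    \<open>x\<close> is listed first, so that it becomes the root \<open>0\<close>.\<close>
  define \<Phi> where "\<Phi> = {P \<in> \<Pi>. P \<noteq> P0 \<and> (\<exists>y\<in>P. (x, y) \<in> R)}"
  have "finite \<Phi>" using fin by (simp add: \<Phi>_def)
  then obtain Ps where Ps: "set Ps = \<Phi>" "distinct Ps" using finite_distinct_list by blast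
  define n where "n = length Ps"
  \<comment> \<open>The default beyond \<open>n\<close> keeps every \<open>e i\<close> in
    \<open>\<D>\<close>, as is required for a substitution of all variables.\<close>
  define e where "e i = (if i \<le> n then (P0 # Ps) ! i else P0)" for i
  have e0: "e 0 = P0" by (simp add: e_def)
  have e_img: "e ` {..n} = insert P0 \<Phi>"
  proof -
    have "e ` {..n} = (!) (P0 # Ps) ` {..<length (P0 # Ps)}"
      by (intro image_cong) (auto simp: e_def n_def)
    also have "\<dots> = set (P0 # Ps)"
      using nth_image[of "length (P0 # Ps)" "P0 # Ps"] by (simp add: atLeast0LessThan)
    finally show ?thesis by (simp add: Ps(1))
  qed
  have e_inj: "i = j" if "i \<le> n" "j \<le> n" "e i = e j" for i j
  proof -
    have "distinct (P0 # Ps)" using Ps by (auto simp: \<Phi>_def)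
    then show ?thesis using that nth_eq_iff_index_eq[of "P0 # Ps" i j] by (simp add: e_def n_def)
  qed
  have e_PI: "e i \<in> \<Pi>" for i
  proof (cases "i \<le> n")
    case True
    then have "e i \<in> insert P0 \<Phi>" using e_img by blast
    then show ?thesis using P0 by (auto simp: \<Phi>_def)
  qed (simp add: e_def P0)
  have e_disj: "i = j" if "i \<le> n" "j \<le> n" "y \<in> e i" "y \<in> e j" for i j y
  proof (rule e_inj[OF that(1,2)], rule ccontr)
    assume "e i \<noteq> e j"
    then have "e i \<inter> e j = {}" using dis e_PI by (auto simp: pairwise_def disjnt_def)
    with that show False by blast
  qed
  have e_reach: "\<exists>i\<le>n. y \<in> e i" if y: "(x, y) \<in> R\<^sup>=" "y \<in> \<Union>\<Pi>" for y
  proof -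
    obtain Q where Q: "Q \<in> \<Pi>" "y \<in> Q" using y(2) by blast
    have "Q \<in> insert P0 \<Phi>"
    proof (cases "y = x")
      case True
      then have "Q = P0" using dis Q P0 by (auto simp: pairwise_def disjnt_def)
      then show ?thesis by simp
    next
      case False
      then show ?thesis using y Q by (auto simp: \<Phi>_def)
    qed
    then show ?thesis using e_img Q(2) by (metis imageE atMost_iff)
  qed
  have e_root: "\<exists>y\<in>e i. (x, y) \<in> R" if "i \<le> n" "i \<noteq> 0" for i
  proof -
    have "e i \<noteq> P0" using e_inj[OF that(1), of 0] e0 that(2) by auto
    moreover have "e i \<in> insert P0 \<Phi>" using that(1) e_img by blast
    ultimately show ?thesis by (simp add: \<Phi>_def)
  qed
  \<comment> \<open>Every class listed meets the part above \<open>x\<close>. What \<open>y\<close>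
    sees is thus also seen, up to its class, from a point above \<open>x\<close>.\<close>
  have e_reach': "\<exists>j\<le>n. z \<in> e j" if yz: "i \<le> n" "y \<in> e i" "(y, z) \<in> R" "z \<in> \<Union>\<Pi>" for i y z
  proof -
    obtain Q where Q: "Q \<in> \<Pi>" "z \<in> Q" using yz(4) by blast
    obtain x' where x': "x' \<in> e i" "(x, x') \<in> R\<^sup>=" using e_root[OF yz(1)] e0 P0(2) by auto
    obtain z' where "z' \<in> Q" "(x', z') \<in> R"
      using pm[OF e_PI Q(1) yz(2) x'(1)] Q(2) yz(3) by blast
    moreover from this have "(x, z') \<in> R\<^sup>=" using x'(2) tr by blast
    ultimately obtain j where "j \<le> n" "z' \<in> e j" using e_reach Q(1) by blast
    then have "e j = Q"
      using dis e_PI[of j] Q(1) \<open>z' \<in> Q\<close> by (auto simp: pairwise_def disjnt_def)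
    then show ?thesis using Q(2) \<open>j \<le> n\<close> by blast
  qed
  \<comment> \<open>The existential quantifiers are harmless: \<open>pm\<close> lets one pair of
    related points speak for the whole class, and variables of \<open>A\<close> are constant on a
    class.\<close>
  define F where "F = {(i, j). i \<le> n \<and> j \<le> n \<and> (\<exists>y\<in>e i. \<exists>z\<in>e j. (y, z) \<in> R)}"
  define V where "V i q \<longleftrightarrow> (\<exists>y\<in>e i. U y q)" for i q
  have Fn: "F \<subseteq> {..n} \<times> {..n}" by (auto simp: F_def)
  have F_step: "\<exists>z\<in>e j. (y, z) \<in> R" if "(i, j) \<in> F" "y \<in> e i" for i j y
    using that pm[OF e_PI e_PI, of _ i y j] by (auto simp: F_def)
  have "trans F"
  proof (rule transI)
    fix i j k assume ij: "(i, j) \<in> F" and jk: "(j, k) \<in> F"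
    obtain y z where yz: "y \<in> e i" "z \<in> e j" "(y, z) \<in> R" using ij by (auto simp: F_def)
    obtain w where "w \<in> e k" "(z, w) \<in> R" using F_step[OF jk yz(2)] by blast
    then show "(i, k) \<in> F" using yz tr[OF yz(3)] ij jk by (auto simp: F_def)
  qed
  moreover have "(0, i) \<in> F" if "i \<le> n" "i \<noteq> 0" for i
    using e_root[OF that] that P0(2) e0 by (auto simp: F_def)
  ultimately have rooted: "rooted_frame n F" using Fn by (simp add: rooted_frame_def)
  have truth: "sat F V i B \<longleftrightarrow> sat R U y B" if "i \<le> n" "y \<in> e i" "B \<in> subfms A" for i y B
    using that
  proof (induction B arbitrary: i y)
    case (Var q)
    have "U z q \<longleftrightarrow> U y q" if "z \<in> e i" for z
      using t_sat[OF tc[OF e_PI that Var.prems(2)] Var.prems(3)] by simp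
    then show ?case using Var.prems(2) unfolding V_def sat.simps by blast
  next
    case (Box B)
    note B = subfms_Box[OF Box.prems(3)]
    show ?case
    proof
      assume *: "sat F V i (\<box> B)"
      have vis: "sat R U z B" if z: "(y, z) \<in> R" "z \<in> \<Union>\<Pi>" for z
      proof -
        obtain j where j: "j \<le> n" "z \<in> e j" using e_reach'[OF Box.prems(1,2) z] by blast
        then have "(i, j) \<in> F" using Box.prems z by (auto simp: F_def)
        then show ?thesis using * Box.IH[OF j B] by simp
      qed
      \<comment> \<open>A discarded successor is replaced by the selected point of its own type that
        it sees; by transitivity \<open>y\<close> sees that point too.\<close>
      have "sat R U z B" if z: "(y, z) \<in> R" for z
      proof (cases "z \<in> \<Union>\<Pi>")
        case True
        then show ?thesis using vis z by blast
      next
        case False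
        then obtain z' where z': "z' \<in> \<Union>\<Pi>" "(z, z') \<in> R" "t z' = t z"
          using disc[of z] RW[OF z] by blast
        then show ?thesis using vis[OF tr[OF z z'(2)] z'(1)] t_sat[OF z'(3) B] by simp
      qed
      then show "sat R U y (\<box> B)" by simp
    next
      assume *: "sat R U y (\<box> B)"
      have "sat F V j B" if ij: "(i, j) \<in> F" for j
      proof -
        obtain z where z: "z \<in> e j" "(y, z) \<in> R" using F_step[OF ij Box.prems(2)] by blast
        have "j \<le> n" using ij by (simp add: F_def)
        then show ?thesis using Box.IH[OF _ z(1) B] z(2) * by simp
      qed
      then show "sat F V i (\<box> B)" by simp
    qed
  next
    case (And B C)
    show ?case using And.IH[OF And.prems(1,2)] subfms_trans[OF And.prems(3)]
        subfms_refl[of B] subfms_refl[of C] by auto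
  next
    case (Or B C)
    show ?case using Or.IH[OF Or.prems(1,2)] subfms_trans[OF Or.prems(3)]
        subfms_refl[of B] subfms_refl[of C] by auto
  next
    case (Imp B C)
    show ?case using Imp.IH[OF Imp.prems(1,2)] subfms_trans[OF Imp.prems(3)]
        subfms_refl[of B] subfms_refl[of C] by auto
  next
    case (Tilde B)
    show ?case using Tilde.IH[OF Tilde.prems(1,2)] subfms_trans[OF Tilde.prems(3)]
        subfms_refl[of B] by auto
  qed
  have A: "\<not> sat F V 0 A" using truth[of 0 x A] P0(2) e0 xA subfms_refl by simp
  let ?V = "\<lambda>y i. y \<notin> e i"
  let ?pts = "pts n ?V" and ?seen = "seen n R ?V"
  have pts_iff: "i \<in> ?pts y \<longleftrightarrow> i \<le> n \<and> y \<in> e i" for i y by (simp add: pts_def)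
  have seen_iff: "i \<in> ?seen y \<longleftrightarrow> i \<le> n \<and> (\<exists>z\<in>e i. (y, z) \<in> R)" for i y
    by (auto simp: seen_def pts_def)
  \<comment> \<open>All selected points at or above \<open>x\<close> lie in listed classes. A point
    outside the domain is therefore discarded and sees a listed class of its own type.\<close>
  have outside: "\<exists>a\<in>?seen y. \<exists>z\<in>e a. (y, z) \<in> R \<and> t z = t y"
    if y: "(x, y) \<in> R\<^sup>=" "?pts y = {}" for y
  proof -
    have "y \<in> W" using y(1) RW P0(2) PW[OF P0(1)] by blast
    moreover have "y \<notin> \<Union>\<Pi>" using e_reach[OF y(1)] y(2) pts_iff by blast
    ultimately obtain z where z: "z \<in> \<Union>\<Pi>" "(y, z) \<in> R" "t z = t y" using disc by blast
    have "(x, z) \<in> R\<^sup>=" using y(1) z(2) tr by blast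
    then obtain a where "a \<le> n" "z \<in> e a" using e_reach z(1) by blast
    then show ?thesis using z seen_iff by blast
  qed
  have inside: "?seen y = F `` {i} \<and> ?pts y = {i}" if "i \<in> ?pts y" for y i
  proof
    have i: "i \<le> n" "y \<in> e i" using that pts_iff by blast+
    show "?pts y = {i}" using e_disj[OF i(1) _ i(2)] i pts_iff by blast
    have "j \<in> ?seen y \<longleftrightarrow> (i, j) \<in> F" for j
    proof
      assume "j \<in> ?seen y"
      then show "(i, j) \<in> F" using i unfolding seen_iff F_def by blast
    next
      assume "(i, j) \<in> F"
      then show "j \<in> ?seen y" using F_step[OF _ i(2)] Fn seen_iff by blast
    qed
    then show "?seen y = F `` {i}" by blast
  qed
  \<comment> \<open>Such a \<open>y\<close> would see exactly \<open>upc F d\<close>, including a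
    class \<open>a\<close> of its own type. The boxed subformulas true at \<open>a\<close> are true
    at \<open>y\<close>, so \<open>a\<close> fits and \<open>d\<close> is no closed domain.\<close>
  have closed: "\<not> d \<subseteq> ?seen y"
    if y: "(x, y) \<in> R\<^sup>=" "?pts y = {}" and d: "d \<in> closed_domains n F V A" "?seen y \<subseteq> upc F d" for y d
  proof
    assume sub: "d \<subseteq> ?seen y"
    obtain a z where a: "a \<in> ?seen y" "z \<in> e a" "(y, z) \<in> R" "t z = t y"
      using outside[OF y] by blast
    have up: "upc F d \<subseteq> ?seen y"
    proof
      fix k assume "k \<in> upc F d"
      then consider "k \<in> d" | j where "j \<in> d" "(j, k) \<in> F" by (auto simp: upc_def)
      then show "k \<in> ?seen y"
      proof cases
        case 2
        then obtain z where z: "z \<in> e j" "(y, z) \<in> R" using sub seen_iff by blast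
        obtain w where "w \<in> e k" "(z, w) \<in> R" using F_step[OF 2(2) z(1)] by blast
        then show ?thesis using tr[OF z(2)] 2(2) Fn seen_iff by blast
      qed (use sub in blast)
    qed
    have "sat F V u B" if B: "\<box> B \<in> subfms A" "sat F V a (\<box> B)" and u: "u \<in> upc F d" for B u
    proof -
      have "a \<le> n" using a(1) seen_iff by blast
      then have "sat R U z (\<box> B)" using truth[OF _ a(2) B(1)] B(2) by blast
      then have yB: "sat R U y (\<box> B)" using t_sat[OF a(4) B(1)] by blast
      obtain v where v: "u \<le> n" "v \<in> e u" "(y, v) \<in> R" using u up seen_iff by blast
      then have "sat R U v B" using yB by simp
      then show ?thesis using truth[OF v(1,2) subfms_Box[OF B(1)]] by simp
    qed
    then have "fits F V A (upc F d) a" unfolding fits_def using a(1) d(2) by blast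
    then show False using d(1) by (auto simp: closed_domains_def)
  qed
  have Dn: "d \<subseteq> {..n}" if "d \<in> closed_domains n F V A" for d
    using that by (auto simp: closed_domains_def is_antichain_def)
  have "\<not> sat R ?V x (alpha_bot n F (closed_domains n F V A))"
  proof (rule iffD2[OF not_sat_alpha_bot[OF Fn Dn]], assumption, intro conjI allI impI)
    show "0 \<in> ?pts x" using P0(2) e0 by (simp add: pts_iff)
  next
    fix y assume y: "(x, y) \<in> R\<^sup>="
    show "\<forall>i\<in>?pts y. ?seen y = F `` {i} \<and> ?pts y = {i}" using inside by blast
    show "\<forall>d\<in>closed_domains n F V A. ?seen y \<subseteq> upc F d \<longrightarrow> ?pts y = {} \<longrightarrow> \<not> d \<subseteq> ?seen y"
      using closed[OF y] by blast
    show "?pts y \<noteq> {} \<or> ?seen y \<noteq> {}" using outside[OF y] by blast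
  qed
  then show thesis using that[OF rooted A, of x e] P0 PW e_PI PD by blast
qed

section \<open>The canonical model as a general frame\<close>

context normal_logic
begin

definition ext :: "fm \<Rightarrow> fm set set" where
  "ext B = {X \<in> worlds. sat acc val X B}"

lemma acc_worlds: "acc \<subseteq> worlds \<times> worlds"
  by (auto simp: acc_def worlds_def)

lemma general_frame_worlds: "general_frame worlds acc (range ext)"
proof
  fix P Q assume "P \<in> range ext" "Q \<in> range ext"
  then obtain B C where P: "P = ext B" and Q: "Q = ext C" by blast
  have "worlds - P = ext (\<^bold>\<sim> B)" unfolding P by (auto simp: ext_def)
  then show "worlds - P \<in> range ext" by simp
  have "P \<inter> Q = ext (B \<^bold>\<and> C)" unfolding P Q by (auto simp: ext_def)
  then show "P \<inter> Q \<in> range ext" by simp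
  have "acc\<inverse> `` P = ext (\<^bold>\<sim> \<box> \<^bold>\<sim> B)" unfolding P using acc_worlds by (auto simp: ext_def)
  then show "acc\<inverse> `` P \<in> range ext" by simp
next
  have "worlds = ext Top" by (auto simp: ext_def)
  then show "worlds \<in> range ext" by blast
qed (use acc_worlds trans_acc in \<open>auto simp: ext_def\<close>)

text \<open>A definable refutation in the canonical model of \<open>L\<close> keeps the canonical
  formula out of \<open>L\<close>; the implication is checked in the canonical model of K4.\<close>

lemma canonical_nontheorem:
  assumes "A \<notin> L"
  shows "\<exists>\<alpha>\<in>canonical_formulas. \<alpha> \<notin> L \<and> (\<exists>\<sigma>. subst \<sigma> A \<^bold>\<longrightarrow> \<alpha> \<in> K4)"
proof -
  interpret general_frame worlds acc "range ext" by (rule general_frame_worlds)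
  obtain X where X: "X \<in> worlds" "\<not> sat acc val X A" using countermodel assms .
  have dA: "dfn (\<lambda>x. sat acc val x B)" for B by (simp add: dfn_def ext_def[symmetric])
  obtain n F V e x where F: "rooted_frame n F" and V: "\<not> sat F V 0 A"
    and x: "x \<in> worlds" and e: "\<And>i. e i \<in> range ext"
    and ref: "\<not> sat acc (\<lambda>y i. y \<notin> e i) x (alpha_bot n F (closed_domains n F V A))"
    by (rule canonical_refutation[OF dA X], rule that)
  let ?\<alpha> = "alpha_bot n F (closed_domains n F V A)"
  have "\<forall>i. \<exists>C. e i = ext C" using e by blast
  then obtain \<chi> where \<chi>: "\<And>i. e i = ext (\<chi> i)" by metis
  \<comment> \<open>The refuting valuation is definable, so it is the canonical valuation after
    substituting the negated defining formulas. Closure of \<open>L\<close> under substitution then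
    applies.\<close>
  have "sat acc val x (subst (\<lambda>i. \<^bold>\<sim> \<chi> i) ?\<alpha>) \<longleftrightarrow> sat acc (\<lambda>y i. y \<notin> e i) x ?\<alpha>"
    unfolding sat_subst
    by (rule sat_cong[of worlds]) (use acc_worlds x in \<open>auto simp: \<chi> ext_def\<close>)
  then have "?\<alpha> \<notin> L" using ref theorem_sat[OF logic_sb x] by blast
  moreover have "?\<alpha> \<in> canonical_formulas"
    using F unfolding canonical_formulas_def closed_domains_def by blast
  moreover have "subst (pull_back n F V A) A \<^bold>\<longrightarrow> ?\<alpha> \<in> K4"
  proof (rule ccontr)
    interpret K4: normal_logic K4 by unfold_locales (auto intro: K4.intros)
    assume "subst (pull_back n F V A) A \<^bold>\<longrightarrow> ?\<alpha> \<notin> K4"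
    then obtain Y where "\<not> sat K4.acc K4.val Y (subst (pull_back n F V A) A \<^bold>\<longrightarrow> ?\<alpha>)"
      using K4.countermodel by metis
    then show False using pull_back_refutes[OF F V K4.trans_acc] by auto
  qed
  ultimately show ?thesis by blast
qed

end

section \<open>Deductive systems\<close>

lemma derives_axiom: "\<alpha> \<in> fst S \<Longrightarrow> derives S \<Gamma> \<alpha>"
  unfolding derives_def inference_def by (intro exI[of _ "[\<alpha>]"]) simp

text \<open>Inferences of the finitely many premises are concatenated, and the conclusion is
  appended.\<close>

lemma derives_rule:
  assumes "finite prems" "(prems, \<alpha>) \<in> snd S" "\<And>\<beta>. \<beta> \<in> prems \<Longrightarrow> derives S \<Gamma> \<beta>"
  shows "derives S \<Gamma> \<alpha>"
proof -
  define ok where "ok xs \<longleftrightarrow> (\<forall>i < length xs. xs ! i \<in> fst S \<or> xs ! i \<in> \<Gamma> \<or>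
      (\<exists>prems. prems \<subseteq> set (take i xs) \<and> (prems, xs ! i) \<in> snd S))" for xs
  have derives_ok: "derives S \<Gamma> \<beta> \<longleftrightarrow> (\<exists>xs. xs \<noteq> [] \<and> last xs = \<beta> \<and> ok xs)" for \<beta>
    unfolding derives_def inference_def ok_def ..
  have ok_append: "ok (xs @ ys)" if xs: "ok xs" and ys: "ok ys" for xs ys
    unfolding ok_def
  proof (intro allI impI)
    fix i assume i: "i < length (xs @ ys)"
    show "(xs @ ys) ! i \<in> fst S \<or> (xs @ ys) ! i \<in> \<Gamma> \<or>
      (\<exists>prems. prems \<subseteq> set (take i (xs @ ys)) \<and> (prems, (xs @ ys) ! i) \<in> snd S)"
    proof (cases "i < length xs")
      case True
      then show ?thesis using xs by (simp add: ok_def nth_append)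
    next
      case False
      then have "i - length xs < length ys" using i by simp
      then have "ys ! (i - length xs) \<in> fst S \<or> ys ! (i - length xs) \<in> \<Gamma> \<or>
        (\<exists>prems. prems \<subseteq> set (take (i - length xs) ys) \<and> (prems, ys ! (i - length xs)) \<in> snd S)"
        using ys by (simp add: ok_def)
      then show ?thesis using False by (auto simp: nth_append)
    qed
  qed
  have "\<exists>xs. ok xs \<and> prems \<subseteq> set xs"
    using assms(1,3)
  proof (induction prems rule: finite_induct)
    case empty
    show ?case by (intro exI[of _ "[]"]) (simp add: ok_def)
  next
    case (insert \<beta> prems)
    then obtain xs ys where "ok xs" "prems \<subseteq> set xs" "ys \<noteq> []" "last ys = \<beta>" "ok ys"
      using derives_ok by (metis insertI1 insertI2)
    then show ?case
      using ok_append[of xs ys] last_in_set[of ys] by (intro exI[of _ "xs @ ys"]) auto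
  qed
  then obtain xs where xs: "ok xs" "prems \<subseteq> set xs" by blast
  have "ok (xs @ [\<alpha>])"
    using xs assms(2) by (auto simp: ok_def less_Suc_eq nth_append)
  then show ?thesis unfolding derives_ok by (intro exI[of _ "xs @ [\<alpha>]"]) simp
qed

lemma derives_sound:
  assumes ax: "\<And>\<beta>. \<beta> \<in> fst S \<union> \<Gamma> \<Longrightarrow> Q \<beta>"
    and rule: "\<And>prems \<beta>. (prems, \<beta>) \<in> snd S \<Longrightarrow> (\<And>\<gamma>. \<gamma> \<in> prems \<Longrightarrow> Q \<gamma>) \<Longrightarrow> Q \<beta>"
    and "derives S \<Gamma> \<alpha>"
  shows "Q \<alpha>"
proof -
  obtain xs where xs: "inference S \<Gamma> xs \<alpha>" using assms(3) by (auto simp: derives_def)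
  have "Q (xs ! i)" if "i < length xs" for i
    using that
  proof (induction i rule: less_induct)
    case (less i)
    then consider "xs ! i \<in> fst S \<union> \<Gamma>"
      | prems where "prems \<subseteq> set (take i xs)" "(prems, xs ! i) \<in> snd S"
      using xs unfolding inference_def by blast
    then show ?case
    proof cases
      case 2
      then have "Q \<gamma>" if "\<gamma> \<in> prems" for \<gamma>
        using that less by (auto simp: in_set_conv_nth subset_iff)
      then show ?thesis by (rule rule[OF 2(2)])
    qed (rule ax)
  qed
  moreover have "\<alpha> = xs ! (length xs - 1)" "xs \<noteq> []"
    using xs by (auto simp: inference_def last_conv_nth)
  ultimately show ?thesis by simp
qed

theorem theorem4p2:
  fixes Lp Lm :: "fm set"
  assumes "(Lp, Lm) \<in> NExtK4"
  shows "\<exists>P N Ax. P \<subseteq> canonical_formulas \<and> N \<subseteq> canonical_formulas \<and>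
           Ax = {\<oplus> A | A. A \<in> K4_axioms} \<union> {\<oplus> A | A. A \<in> P} \<union> {\<ominus> A | A. A \<in> N} \<and>
           standard_system (Ax, modal_rules) \<and>
           (\<forall>A. (derivable (Ax, modal_rules) (\<oplus> A) \<longleftrightarrow> A \<in> Lp) \<and>
                (derivable (Ax, modal_rules) (\<ominus> A) \<longleftrightarrow> A \<in> Lm))"
proof -
  have Lm: "Lm = UNIV - Lp" and L: "normal_logic Lp"
    using assms unfolding NExtK4_def by (auto intro!: normal_logic.intro)
  interpret Lp: normal_logic Lp by (rule L)
  define P where "P = canonical_formulas \<inter> Lp"
  define N where "N = canonical_formulas - Lp"
  define Ax where "Ax = {\<oplus> A | A. A \<in> K4_axioms} \<union> {\<oplus> A | A. A \<in> P} \<union> {\<ominus> A | A. A \<in> N}"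
  let ?S = "(Ax, modal_rules)"
  \<comment> \<open>The positive rules preserve this reading by closure of \<open>Lp\<close>; each
    negative rule is the contrapositive of a positive one.\<close>
  define holds where "holds s = (case s of \<oplus> A \<Rightarrow> A \<in> Lp | \<ominus> A \<Rightarrow> A \<notin> Lp)" for s
  have sound: "holds s" if "derivable ?S s" for s
  proof (rule derives_sound[OF _ _ that])
    fix s assume "s \<in> fst ?S \<union> {}"
    then show "holds s"
      using K4.ax subsetD[OF Lp.logic_K4] by (auto simp: Ax_def P_def N_def holds_def)
  next
    fix prems s assume "(prems, s) \<in> snd ?S" and prems: "\<And>r. r \<in> prems \<Longrightarrow> holds r"
    then have "(prems, s) \<in> modal_rules" "\<forall>r\<in>prems. holds r" by auto
    then show "holds s"
      by cases (auto simp: holds_def intro: Lp.logic_mp Lp.logic_sb Lp.logic_nec)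
  qed
  have MP: "derivable ?S (\<oplus> B)" if "derivable ?S (\<oplus> (A \<^bold>\<longrightarrow> B))" "derivable ?S (\<oplus> A)" for A B
    by (rule derives_rule[of "{\<oplus> (A \<^bold>\<longrightarrow> B), \<oplus> A}"]) (use that in \<open>auto intro: modal_rules.MP\<close>)
  have Sb: "derivable ?S (\<oplus> (subst \<sigma> A))" if "derivable ?S (\<oplus> A)" for A \<sigma>
    by (rule derives_rule[of "{\<oplus> A}"]) (use that in \<open>auto intro: modal_rules.Sb\<close>)
  have NS: "derivable ?S (\<oplus> (\<box> A))" if "derivable ?S (\<oplus> A)" for A
    by (rule derives_rule[of "{\<oplus> A}"]) (use that in \<open>auto intro: modal_rules.NS\<close>)
  have MT: "derivable ?S (\<ominus> A)" if "derivable ?S (\<oplus> (A \<^bold>\<longrightarrow> B))" "derivable ?S (\<ominus> B)" for A B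
    by (rule derives_rule[of "{\<oplus> (A \<^bold>\<longrightarrow> B), \<ominus> B}"]) (use that in \<open>auto intro: modal_rules.MT\<close>)
  have RS: "derivable ?S (\<ominus> A)" if "derivable ?S (\<ominus> (subst \<sigma> A))" for A \<sigma>
    by (rule derives_rule[of "{\<ominus> (subst \<sigma> A)}"]) (use that in \<open>auto intro: modal_rules.RS\<close>)
  have K4: "derivable ?S (\<oplus> A)" if "A \<in> K4" for A
    using that
  proof induction
    case (ax A)
    then show ?case by (intro derives_axiom) (simp add: Ax_def)
  next
    case (mp A B)
    show ?case by (rule MP[OF mp.IH])
  next
    case (sb A \<sigma>)
    show ?case by (rule Sb[OF sb.IH])
  next
    case (nec A)
    show ?case by (rule NS[OF nec.IH])
  qed
  \<comment> \<open>The formulas derivable positively form a normal logic, not yet known to be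
    \<open>Lp\<close>, to which \<open>canonical_nontheorem\<close> applies as well.\<close>
  let ?D = "{A. derivable ?S (\<oplus> A)}"
  interpret D: normal_logic ?D
    by unfold_locales (auto intro: K4 MP Sb NS)
  have neg: "derivable ?S (\<ominus> A)" if "A \<notin> Lp" for A
  proof -
    obtain \<alpha> \<sigma> where \<alpha>: "\<alpha> \<in> canonical_formulas" "\<alpha> \<notin> Lp" "subst \<sigma> A \<^bold>\<longrightarrow> \<alpha> \<in> K4"
      using Lp.canonical_nontheorem[OF \<open>A \<notin> Lp\<close>] by blast
    then have "derivable ?S (\<ominus> \<alpha>)" by (intro derives_axiom) (simp add: Ax_def N_def)
    then show ?thesis using RS MT K4[OF \<alpha>(3)] by blast
  qed
  \<comment> \<open>If \<open>A\<close> were not derivable, some canonical formula outside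
    \<open>?D\<close> would be implied by an instance of \<open>A\<close>. It would then be in
    \<open>Lp\<close>, hence an axiom from \<open>P\<close>.\<close>
  have pos: "derivable ?S (\<oplus> A)" if "A \<in> Lp" for A
  proof (rule ccontr)
    assume "\<not> derivable ?S (\<oplus> A)"
    then obtain \<alpha> \<sigma> where \<alpha>: "\<alpha> \<in> canonical_formulas" "\<not> derivable ?S (\<oplus> \<alpha>)"
        "subst \<sigma> A \<^bold>\<longrightarrow> \<alpha> \<in> K4"
      using D.canonical_nontheorem[of A] by auto
    have "\<alpha> \<in> Lp" using Lp.logic_mp Lp.logic_sb[OF that] \<alpha>(3) Lp.logic_K4 by blast
    then have "derivable ?S (\<oplus> \<alpha>)" using \<alpha>(1) by (intro derives_axiom) (simp add: Ax_def P_def)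
    with \<alpha>(2) show False by simp
  qed
  have Pos: "derivable ?S (\<oplus> A) \<longleftrightarrow> A \<in> Lp" for A
    using pos[of A] sound[of "\<oplus> A"] unfolding holds_def stmt.case by blast
  have Neg: "derivable ?S (\<ominus> A) \<longleftrightarrow> A \<in> Lm" for A
    using neg[of A] sound[of "\<ominus> A"] unfolding holds_def stmt.case Lm by blast
  have "standard_system ?S"
    unfolding standard_system_def coherent_system_def full_system_def Pos Neg by (simp add: Lm)
  moreover have "P \<subseteq> canonical_formulas" "N \<subseteq> canonical_formulas" by (auto simp: P_def N_def)
  ultimately show ?thesis
    using Ax_def Pos Neg by (intro exI[of _ P] exI[of _ N] exI[of _ Ax] conjI allI)
qed

end
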